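(* Let $\mathfrak{n}$ be a $p$-step nilpotent Lie algebra, $p>1$, and let $\mathfrak{z}$ be the center of $\mathfrak{n}$. (1) If $\dim\mathfrak{n} \ge \big((p-1)^2+p^2\big)\dim\mathfrak{z}$ then \[ \mu_{nil}(\mathfrak{n})\ge \sqrt{\frac{2p}{p-1}(\dim\mathfrak{n}-\dim\mathfrak{z})}. \] (2) If $\dim\mathfrak{n} \le \big((p-1)^2+p^2\big)\dim\mathfrak{z}$ then \[ \mu_{nil}(\mathfrak{n})\ge \sqrt{\frac{2(p-1)}{p-2}\dim\mathfrak{n} +\frac{2p(p-1)}{(p-2)^2}\dim\mathfrak{z}}\,-\,\frac{2}{p-2}\sqrt{\dim\mathfrak{z}} \] if $p\ne 2$, and $\mu_{nil}(\mathfrak{n})\ge \dfrac{\dim\mathfrak{n}+3\dim\mathfrak{z}}{2\sqrt{\dim\mathfrak{z}}}$ if $p=2$. In both cases, the given bound is bigger than $\sqrt{ \frac{2(p+1)}{p} \dim \mathfrak{n}}$.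
   Context: All Lie algebras and representations are finite dimensional over a field $\mathrm{k}$ of characteristic zero. A nilrepresentation of a nilpotent Lie algebra $\mathfrak{n}$ is a representation $(\pi,V)$ such that $\pi(X)$ is a nilpotent endomorphism for all $X\in\mathfrak{n}$, and $\mu_{nil}(\mathfrak{n})=\min\{\dim V : (\pi,V)\text{ is a faithful nilrepresentation of }\mathfrak{n}\}$. A Lie algebra is $p$-step nilpotent if the $p$-th term of its lower central series (with first term $\mathfrak{n}$) is nonzero and the $(p+1)$-st term is zero.
   Formalization: In case (2), "bigger than" is proved as "at least" (≥): equality occurs, e.g. for the Heisenberg algebra (p=2, dim n=3, dim z=1), where both sides equal 3. In case (1) the bound is strictly bigger. *)

theory Defs
  imports
    Complex_Main
    "HOL-Library.Function_Algebras"
    "HOL-Library.FuncSet"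
    "HOL-Library.Extended_Nat"
    "HOL-Library.Extended_Real"
begin

locale lie_algebra = vector_space scale
  for scale :: "'k::field_char_0 \<Rightarrow> 'a::ab_group_add \<Rightarrow> 'a" +
  fixes bracket :: "'a \<Rightarrow> 'a \<Rightarrow> 'a"
  assumes bracket_add_left: "bracket (x + y) z = bracket x z + bracket y z"
    and bracket_add_right: "bracket x (y + z) = bracket x y + bracket x z"
    and bracket_scale_left: "bracket (scale c x) y = scale c (bracket x y)"
    and bracket_scale_right: "bracket x (scale c y) = scale c (bracket x y)"
    and bracket_self: "bracket x x = 0"
    and jacobi: "bracket x (bracket y z) + bracket y (bracket z x) + bracket z (bracket x y) = 0"
begin

definition center :: "'a set" where
  "center = {z. \<forall>x. bracket x z = 0}"

text \<open>Indexing starts at 0, so \<open>lower_central i\<close> is the \<open>(i+1)\<close>-st term of the lower central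
  series, the first term being the whole algebra.\<close>

primrec lower_central :: "nat \<Rightarrow> 'a set" where
  "lower_central 0 = UNIV"
| "lower_central (Suc i) = span {bracket x y |x y. y \<in> lower_central i}"

definition step_nilpotent :: "nat \<Rightarrow> bool" where
  "step_nilpotent p \<longleftrightarrow> 0 < p \<and> lower_central (p - 1) \<noteq> {0} \<and> lower_central p = {0}"

end

text \<open>A finite dimensional representation whose space is a subspace \<open>V\<close> of a vector space on the
  type \<open>'v\<close>. Only the restrictions of the maps \<open>\<pi> x\<close> to \<open>V\<close> matter; outside \<open>V\<close> their values are
  arbitrary.\<close>

locale lie_representation = lie_algebra scale bracket + V: vector_space scaleV
  for scale :: "'k::field_char_0 \<Rightarrow> 'a::ab_group_add \<Rightarrow> 'a"
    and bracket :: "'a \<Rightarrow> 'a \<Rightarrow> 'a"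
    and scaleV :: "'k \<Rightarrow> 'v::ab_group_add \<Rightarrow> 'v" +
  fixes V :: "'v set" and \<pi> :: "'a \<Rightarrow> 'v \<Rightarrow> 'v"
  assumes finite_dim: "\<exists>B. finite B \<and> V.span B = V"
    and rep_closed: "v \<in> V \<Longrightarrow> \<pi> x v \<in> V"
    and rep_add: "v \<in> V \<Longrightarrow> w \<in> V \<Longrightarrow> \<pi> x (v + w) = \<pi> x v + \<pi> x w"
    and rep_scale: "v \<in> V \<Longrightarrow> \<pi> x (scaleV c v) = scaleV c (\<pi> x v)"
    and rep_add_left: "v \<in> V \<Longrightarrow> \<pi> (x + y) v = \<pi> x v + \<pi> y v"
    and rep_scale_left: "v \<in> V \<Longrightarrow> \<pi> (scale c x) v = scaleV c (\<pi> x v)"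
    and rep_bracket: "v \<in> V \<Longrightarrow> \<pi> (bracket x y) v = \<pi> x (\<pi> y v) - \<pi> y (\<pi> x v)"

locale faithful_nilrepresentation = lie_representation +
  assumes rep_nilpotent: "\<exists>m. \<forall>v\<in>V. (\<pi> x ^^ m) v = 0"
    and rep_faithful: "inj (\<lambda>x. restrict (\<pi> x) V)"

definition fun_scale :: "'k::field \<Rightarrow> (nat \<Rightarrow> 'k) \<Rightarrow> nat \<Rightarrow> 'k" where
  "fun_scale c f = (\<lambda>i. c * f i)"

text \<open>The representation spaces are taken inside the sequence space \<open>nat \<Rightarrow> 'k\<close>, which contains an
  isomorphic copy of every finite dimensional space; the lemma \<open>mu_nil_le\<close> below shows that
  representations on arbitrary types do not give anything smaller. The infimum is attained as soon
  as a faithful nilrepresentation exists (which is Birkhoff's theorem when the algebra is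
  nilpotent); the infimum of the empty set would be \<open>\<infinity>\<close>.\<close>

definition (in lie_algebra) mu_nil :: enat where
  "mu_nil = Inf {enat (vector_space.dim fun_scale V) |V \<pi>.
     faithful_nilrepresentation scale bracket fun_scale V \<pi>}"

lemma vector_space_fun_scale: "vector_space (fun_scale :: 'k::field \<Rightarrow> _)"
  by unfold_locales (auto simp: fun_scale_def fun_eq_iff algebra_simps)

lemma (in lie_algebra) mu_nil_le:
  fixes scaleW :: "'k \<Rightarrow> 'w::ab_group_add \<Rightarrow> 'w"
  assumes "faithful_nilrepresentation scale bracket scaleW W \<rho>"
  shows "mu_nil \<le> enat (vector_space.dim scaleW W)"
proof -
  interpret R: faithful_nilrepresentation scale bracket scaleW W \<rho> by fact
  interpret F: vector_space "fun_scale :: 'k \<Rightarrow> _" by (rule vector_space_fun_scale)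
  obtain B0 where B0: "finite B0" "R.V.span B0 = W" using R.finite_dim by blast
  have sW: "R.V.subspace W" using B0 R.V.subspace_span by blast
  obtain B where B: "B \<subseteq> W" "R.V.independent B" "W \<subseteq> R.V.span B" "card B = R.V.dim W"
    using R.V.basis_exists by blast
  have finB: "finite B"
    using R.V.independent_span_bound[OF B0(1) B(2)] B(1) B0(2) by blast
  have spB: "R.V.span B = W"
    using B sW R.V.span_minimal by blast
  define d where "d = R.V.dim W"
  obtain e where e: "bij_betw e {..<d} B"
    using ex_bij_betw_nat_finite[OF finB] B(4) by (auto simp: d_def lessThan_atLeast0)
  have eB: "e i \<in> B" if "i < d" for i using e that by (auto simp: bij_betw_def)
  have einj: "e i = e j \<longleftrightarrow> i = j" if "i < d" "j < d" for i j
    using e that by (auto simp: bij_betw_def inj_on_def)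
  define V where "V = {f :: nat \<Rightarrow> 'k. \<forall>i\<ge>d. f i = 0}"
  define \<psi> where "\<psi> f = (\<Sum>i<d. scaleW (f i) (e i))" for f :: "nat \<Rightarrow> 'k"
  define \<phi> where "\<phi> w = (\<lambda>i. if i < d then R.V.representation B w (e i) else 0)" for w
  have \<psi>W: "\<psi> f \<in> W" for f
    unfolding \<psi>_def using eB B(1) sW by (intro R.V.subspace_sum R.V.subspace_scale) auto
  have \<phi>V: "\<phi> w \<in> V" for w by (simp add: \<phi>_def V_def)
  have \<psi>\<phi>: "\<psi> (\<phi> w) = w" if "w \<in> W" for w
  proof -
    have "\<psi> (\<phi> w) = (\<Sum>i<d. scaleW (R.V.representation B w (e i)) (e i))"
      by (simp add: \<psi>_def \<phi>_def)
    also have "\<dots> = (\<Sum>b\<in>B. scaleW (R.V.representation B w b) b)"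
      by (rule sum.reindex_bij_betw[OF e])
    also have "\<dots> = w"
      using R.V.sum_representation_eq[OF B(2) _ finB order_refl] spB that by simp
    finally show ?thesis .
  qed
  have \<phi>\<psi>: "\<phi> (\<psi> f) = f" if "f \<in> V" for f
  proof
    fix i
    show "\<phi> (\<psi> f) i = f i"
    proof (cases "i < d")
      case True
      have "R.V.representation B (\<psi> f) (e i)
          = (\<Sum>j<d. R.V.representation B (scaleW (f j) (e j)) (e i))"
        unfolding \<psi>_def using eB B(1) sW spB
        by (subst R.V.representation_sum[OF B(2)]) (auto intro!: R.V.subspace_scale)
      also have "\<dots> = (\<Sum>j<d. f j * (if i = j then 1 else 0))"
      proof (rule sum.cong[OF refl])
        fix j assume "j \<in> {..<d}"
        then have j: "j < d" by simp
        have "R.V.representation B (scaleW (f j) (e j)) (e i)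
            = f j * R.V.representation B (e j) (e i)"
          using R.V.representation_scale[OF B(2)] eB[OF j] R.V.span_base by simp
        also have "\<dots> = f j * (if i = j then 1 else 0)"
          using R.V.representation_basis[OF B(2) eB[OF j]] einj[OF True j] by simp
        finally show "R.V.representation B (scaleW (f j) (e j)) (e i)
            = f j * (if i = j then 1 else 0)" .
      qed
      also have "\<dots> = f i" using True by (simp add: if_distrib cong: if_cong)
      finally show ?thesis using True by (simp add: \<phi>_def)
    qed (use that in \<open>simp add: \<phi>_def V_def\<close>)
  qed
  have \<psi>add: "\<psi> (f + g) = \<psi> f + \<psi> g" for f g
    by (simp add: \<psi>_def R.V.scale_left_distrib sum.distrib)
  have \<psi>scale: "\<psi> (fun_scale c f) = scaleW c (\<psi> f)" for c f
    by (simp add: \<psi>_def fun_scale_def R.V.scale_sum_right)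
  have \<phi>add: "\<phi> (v + w) = \<phi> v + \<phi> w" if "v \<in> W" "w \<in> W" for v w
    using that spB by (auto simp: \<phi>_def fun_eq_iff R.V.representation_add[OF B(2)])
  have \<phi>diff: "\<phi> (v - w) = \<phi> v - \<phi> w" if "v \<in> W" "w \<in> W" for v w
    using that spB by (auto simp: \<phi>_def fun_eq_iff R.V.representation_diff[OF B(2)])
  have \<phi>scale: "\<phi> (scaleW c v) = fun_scale c (\<phi> v)" if "v \<in> W" for c v
    using that spB by (auto simp: \<phi>_def fun_scale_def fun_eq_iff R.V.representation_scale[OF B(2)])
  have \<phi>0: "\<phi> 0 = 0" by (simp add: \<phi>_def fun_eq_iff R.V.representation_zero)
  define \<pi> where "\<pi> x f = \<phi> (\<rho> x (\<psi> f))" for x f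
  define E where "E = (\<lambda>j i. if i = j then 1 else 0 :: 'k) ` {..<d}"
  have sV: "F.subspace V" by (auto simp: F.subspace_def V_def fun_scale_def)
  have EV: "E \<subseteq> V" by (auto simp: E_def V_def)
  have VE: "V \<subseteq> F.span E"
  proof
    fix f assume f: "f \<in> V"
    have app: "sum g A i = (\<Sum>j\<in>A. g j i)" for g :: "nat \<Rightarrow> nat \<Rightarrow> 'k" and A i
      by (induction A rule: infinite_finite_induct) auto
    have "f = (\<Sum>j<d. fun_scale (f j) (\<lambda>i. if i = j then 1 else 0))"
      using f by (auto simp: fun_eq_iff app fun_scale_def V_def if_distrib cong: if_cong)
    also have "\<dots> \<in> F.span E"
      by (intro F.span_sum F.span_scale F.span_base) (auto simp: E_def)
    finally show "f \<in> F.span E" .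
  qed
  have finE: "finite E" by (simp add: E_def)
  have pow: "(\<pi> x ^^ m) f = \<phi> ((\<rho> x ^^ m) (\<psi> f)) \<and> (\<rho> x ^^ m) (\<psi> f) \<in> W" if "f \<in> V" for x m f
    by (induction m) (use that in \<open>auto simp: \<phi>\<psi> \<psi>W \<pi>_def \<psi>\<phi> R.rep_closed\<close>)
  have "faithful_nilrepresentation scale bracket fun_scale V \<pi>"
  proof unfold_locales
    show "\<exists>B. finite B \<and> F.span B = V"
      using finE F.span_minimal[OF EV sV] VE by blast
    show "\<exists>m. \<forall>v\<in>V. (\<pi> x ^^ m) v = 0" for x
    proof -
      obtain m where "\<forall>w\<in>W. (\<rho> x ^^ m) w = 0" using R.rep_nilpotent by blast
      then show ?thesis using pow \<psi>W \<phi>0 by (intro exI[of _ m]) auto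
    qed
    show "inj (\<lambda>x. restrict (\<pi> x) V)"
    proof (rule injI)
      fix x y assume eq: "restrict (\<pi> x) V = restrict (\<pi> y) V"
      have "\<rho> x w = \<rho> y w" if w: "w \<in> W" for w
      proof -
        have "\<pi> x (\<phi> w) = \<pi> y (\<phi> w)" using fun_cong[OF eq, of "\<phi> w"] \<phi>V by simp
        then have "\<phi> (\<rho> x w) = \<phi> (\<rho> y w)" using w by (simp add: \<pi>_def \<psi>\<phi>)
        then show ?thesis using \<psi>\<phi> R.rep_closed w by metis
      qed
      then have "restrict (\<rho> x) W = restrict (\<rho> y) W" by (auto simp: restrict_def)
      then show "x = y" using R.rep_faithful by (auto dest: injD)
    qed
  qed (auto simp: \<pi>_def \<phi>V \<psi>W \<psi>add \<psi>scale \<psi>\<phi> \<phi>add \<phi>diff \<phi>scale R.rep_closed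
        R.rep_add R.rep_scale R.rep_add_left R.rep_scale_left R.rep_bracket)
  then have "mu_nil \<le> enat (F.dim V)"
    unfolding mu_nil_def by (intro Inf_lower) blast
  also have "F.dim V \<le> card E" using F.dim_le_card[OF VE finE] .
  also have "card E \<le> d" unfolding E_def using card_image_le[of "{..<d}"] by simp
  finally show ?thesis by (simp add: d_def)
qed

end

theory Submission
  imports Defs
begin

text \<open>Let \<open>n\<close> and \<open>z\<close> be the dimensions of the algebra and of its centre, and \<open>m\<close> the dimension of a
faithful nilrepresentation. The idea is to degenerate the algebra to one spanned by matrix units,
where everything becomes a statement about a partial order, and then to solve an extremal problem
of Turan type on that order.

Degeneration. Fix a basis of the representation space and give the position \<open>(i, j)\<close> of a matrix the
weight \<open>2 ^ j - 2 ^ i\<close>. These weights are additive along products of matrix units, and distinct off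
the diagonal. Every nonzero \<open>x\<close> in the algebra has a leading position, the nonzero entry of
smallest weight; it is off the diagonal because \<open>x\<close> acts nilpotently. The set \<open>P\<close> of all leading
positions has exactly \<open>n\<close> elements (Gaussian elimination, \<open>dim_eq_card_lead_positions\<close>) and the set
\<open>Z\<close> of those of central elements has \<open>z\<close>. If \<open>x\<close> leads at \<open>(i, j)\<close> and \<open>y\<close> at \<open>(j, k)\<close>, then
\<open>bracket x y\<close> leads at \<open>(i, k)\<close> (\<open>bracket_lead\<close>). Hence \<open>P\<close> is a strict partial order on
\<open>{..<m}\<close>; the pairs in \<open>Z\<close> join a minimal element to a maximal one; and a chain of \<open>p + 1\<close> elements
has its ends joined by a pair of \<open>Z\<close>, because the iterated bracket along the chain lies in the last
nonzero term of the lower central series, which is central (\<open>lead_chain_center\<close>).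

Extremal problem. Give the pairs in \<open>Z\<close> the weight \<open>\<kappa> \<ge> 0\<close> and the other pairs of \<open>P\<close> the weight 1.
The total weight is the value at the all-ones vector of a quadratic form, and as in the proof of
Motzkin and Straus of the theorem of Turan the form does not decrease when mass is moved suitably
between two incomparable elements. So the mass can be concentrated on a chain. A chain contains at
most one pair of \<open>Z\<close>, and at most \<open>p - 1\<close> elements besides that pair. If \<open>s\<close> is the mass on the pair,
this gives (\<open>weighted_turan\<close>)
\<open>n - z + \<kappa> z \<le> s (m - s) + c (m - s)\<^sup>2 + \<kappa> s\<^sup>2 / 4\<close> with \<open>c = (p - 2) / (2 (p - 1))\<close>.

Optimisation. For \<open>\<kappa> = 0\<close> the right hand side is at most \<open>(p - 1) / (2 p) m\<^sup>2\<close>, which is the first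
bound. The second one comes from the \<open>\<kappa>\<close> for which the right hand side is largest at
\<open>s = 2 sqrt z\<close> (\<open>tangent_bound\<close>): the terms with \<open>\<kappa>\<close> cancel and leave
\<open>n - z \<le> s (m - s) + c (m - s)\<^sup>2\<close>, a quadratic inequality for \<open>m\<close>. No such \<open>\<kappa> \<ge> 0\<close> exists when
\<open>m > 2 p sqrt z\<close>, but under the condition of the second case the bound itself is at most
\<open>2 p sqrt z\<close>.\<close>

section \<open>Dimension counted by leading coordinates\<close>

definition leading :: "'q set \<Rightarrow> ('q \<Rightarrow> 'o::linorder) \<Rightarrow> ('q \<Rightarrow> 'a \<Rightarrow> 'k::zero) \<Rightarrow> 'a \<Rightarrow> 'q \<Rightarrow> bool" where
  "leading Q key c x q \<longleftrightarrow> q \<in> Q \<and> c q x \<noteq> 0 \<and> (\<forall>r\<in>Q. key r < key q \<longrightarrow> c r x = 0)"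

text \<open>This is the count of pivots of an echelon basis. Induction on the set of coordinates: passing to
the kernel of the first coordinate lowers the dimension by one exactly when that coordinate leads
some vector, and does not change which of the other coordinates lead.\<close>
lemma (in finite_dimensional_vector_space) dim_eq_card_leading:
  fixes c :: "'q \<Rightarrow> 'b \<Rightarrow> 'a" and key :: "'q \<Rightarrow> 'o::linorder"
  assumes "finite Q" "inj_on key Q"
    and c_add: "\<And>q x y. c q (x + y) = c q x + c q y"
    and c_scale: "\<And>q a x. c q (scale a x) = a * c q x"
    and "subspace S" "\<And>x. x \<in> S \<Longrightarrow> (\<forall>q\<in>Q. c q x = 0) \<Longrightarrow> x = 0"
  shows "dim S = card {q. \<exists>x\<in>S. leading Q key c x q}"
  using assms(1,2,5,6)
proof (induction "card Q" arbitrary: Q S)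
  case 0
  then have "Q = {}" by simp
  then have "S = {0}" using 0 subspace_0 by auto
  moreover have "{q. \<exists>x\<in>S. leading Q key c x q} = {}"
    using \<open>Q = {}\<close> by (simp add: leading_def)
  ultimately show ?case using dim_span[of "{}"] by simp
next
  case (Suc k)
  have ne: "Q \<noteq> {}" using Suc by auto
  define q0 where "q0 = arg_min_on key Q"
  have q0: "q0 \<in> Q" unfolding q0_def using Suc ne by (intro arg_min_if_finite) auto
  have least: "key q0 \<le> key r" if "r \<in> Q" for r
    unfolding q0_def using Suc ne that by (intro arg_min_least) auto
  have less: "key q0 < key r" if "r \<in> Q" "r \<noteq> q0" for r
    using least[OF that(1)] that q0 Suc(4) by (metis inj_onD order_le_less)
  define Q' where "Q' = Q - {q0}"
  define S' where "S' = {x \<in> S. c q0 x = 0}"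
  define L where "L = {q. \<exists>x\<in>S. leading Q key c x q}"
  define L' where "L' = {q. \<exists>x\<in>S'. leading Q' key c x q}"
  have c0: "c q 0 = 0" for q using c_scale[of q 0 0] by simp
  have S'sub: "subspace S'"
    unfolding S'_def using Suc(5) by (auto simp: subspace_def c_add c_scale c0)
  have IH: "dim S' = card L'"
    unfolding L'_def
  proof (rule Suc(1))
    show "k = card Q'" using Suc q0 by (simp add: Q'_def)
    show "finite Q'" "inj_on key Q'" using Suc by (auto simp: Q'_def inj_on_def)
    show "x = 0" if "x \<in> S'" "\<forall>q\<in>Q'. c q x = 0" for x
      using that Suc(6)[of x] by (auto simp: S'_def Q'_def)
  qed (rule S'sub)
  have fL': "finite L'" using Suc(3) by (auto simp: L'_def leading_def Q'_def intro: finite_subset)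
  have q0L': "q0 \<notin> L'" by (auto simp: L'_def leading_def Q'_def)
  have eqS': "leading Q key c x q \<longleftrightarrow> leading Q' key c x q" if "x \<in> S'" for x q
    using that least by (auto simp: leading_def Q'_def S'_def)
  have eqS: "leading Q key c x q \<longleftrightarrow> q = q0" if "x \<in> S" "x \<notin> S'" for x q
    using that less q0 least by (force simp: leading_def S'_def)
  show ?case
  proof (cases "S' = S")
    case True
    then have "L = L'" unfolding L_def L'_def using eqS' by auto
    then show ?thesis using IH True by (simp add: L_def)
  next
    case False
    then obtain x0 where x0: "x0 \<in> S" "x0 \<notin> S'" by (auto simp: S'_def)
    then have nz: "c q0 x0 \<noteq> 0" by (simp add: S'_def)
    have "L = insert q0 L'"
    proof -
      have "S' \<subseteq> S" by (auto simp: S'_def)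
      then show ?thesis unfolding L_def L'_def using eqS' eqS x0 by auto blast+
    qed
    then have cL: "card L = Suc (card L')" using fL' q0L' by simp
    have "S = span (insert x0 S')"
    proof
      show "span (insert x0 S') \<subseteq> S"
        using x0 Suc(5) by (intro span_minimal) (auto simp: S'_def)
      show "S \<subseteq> span (insert x0 S')"
      proof
        fix x assume x: "x \<in> S"
        define a where "a = c q0 x / c q0 x0"
        have "x + scale (- a) x0 \<in> S"
          using x x0 Suc(5) by (intro subspace_add subspace_scale) auto
        moreover have "c q0 (x + scale (- a) x0) = 0"
          using nz by (simp only: c_add c_scale) (simp add: a_def)
        ultimately have "x + scale (- a) x0 \<in> S'" by (simp add: S'_def)
        then have "(x + scale (- a) x0) + scale a x0 \<in> span (insert x0 S')"
          by (intro span_add span_scale span_base) auto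
        then show "x \<in> span (insert x0 S')" by simp
      qed
    qed
    moreover have "x0 \<notin> span S'" using x0 S'sub by (simp add: span_eq_iff[THEN iffD2])
    ultimately have "dim S = Suc (dim S')" by (metis dim_span dim_insert Suc_eq_plus1)
    then show ?thesis using IH cL by (simp add: L_def)
  qed
qed

section \<open>Leading positions in a Lie algebra of nilpotent matrices\<close>

text \<open>Off the diagonal, the weight of a position determines the position.\<close>
lemma pow2_diff_inj:
  assumes "(2::int) ^ j - 2 ^ i = 2 ^ l - 2 ^ k" "i \<noteq> j"
  shows "i = k \<and> j = l"
  using assms
proof (induction i arbitrary: j k l)
  case 0
  have pos: "(2::int) ^ a \<ge> 1" for a :: nat by simp
  from 0 obtain j' where j: "j = Suc j'" by (cases j) auto
  show ?case
  proof (cases k)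
    case 0
    then show ?thesis using \<open>(2::int) ^ j - 2 ^ 0 = 2 ^ l - 2 ^ k\<close> by simp
  next
    case (Suc k')
    then have "2 * (2::int) ^ j' - 1 = 2 ^ l - 2 * 2 ^ k'" using 0 j by simp
    then have False using pos[of j'] pos[of k'] by (cases l) (simp, simp, presburger)
    then show ?thesis ..
  qed
next
  case (Suc i)
  have pos: "(2::int) ^ a \<ge> 1" for a :: nat by simp
  show ?case
  proof (cases j)
    case 0
    then have e: "1 - 2 * (2::int) ^ i = 2 ^ l - 2 ^ k" using Suc.prems by simp
    show ?thesis
    proof (cases l)
      case 0
      then show ?thesis using e \<open>j = 0\<close> pos[of i] by (cases k) (simp, simp)
    next
      case (Suc l')
      then have "1 - 2 * (2::int) ^ i = 2 * 2 ^ l' - 2 ^ k" using e by simp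
      then have False using pos[of l'] pos[of i] by (cases k) (simp, simp, presburger)
      then show ?thesis ..
    qed
  next
    case (Suc j')
    then have e: "2 * (2::int) ^ j' - 2 * 2 ^ i = 2 ^ l - 2 ^ k" using Suc.prems by simp
    have "i \<noteq> j'" using Suc Suc.prems by simp
    then have ne: "(2::int) ^ j' - 2 ^ i \<noteq> 0" by simp
    obtain k' l' where kl: "k = Suc k'" "l = Suc l'"
    proof (cases k; cases l)
      assume "k = 0" "l = 0"
      then show ?thesis using e ne by simp
    next
      fix b assume "k = 0" "l = Suc b"
      then have "2 * (2::int) ^ j' - 2 * 2 ^ i = 2 * 2 ^ b - 1" using e by simp
      then show ?thesis by presburger
    next
      fix a assume "k = Suc a" "l = 0"
      then have "2 * (2::int) ^ j' - 2 * 2 ^ i = 1 - 2 * 2 ^ a" using e by simp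
      then show ?thesis by presburger
    qed (use that in auto)
    then show ?thesis using Suc e \<open>i \<noteq> j'\<close> Suc.IH[of j' l' k'] by auto
  qed
qed

context lie_algebra
begin

lemma bracket_commute: "bracket x y = - bracket y x"
proof -
  have "bracket (x + y) (x + y) = bracket x y + bracket y x"
    by (simp only: bracket_add_left bracket_add_right) (simp add: bracket_self)
  then show ?thesis using bracket_self[of "x + y"] by (simp add: eq_neg_iff_add_eq_0)
qed

lemma subspace_center: "subspace center"
proof -
  have "bracket x 0 = 0" for x using bracket_scale_right[of x 0 0] by simp
  then show ?thesis
    by (auto simp: subspace_def center_def bracket_add_right bracket_scale_right)
qed

lemma lower_central_subset_center:
  assumes "lower_central (Suc q) = {0}"
  shows "lower_central q \<subseteq> center"
proof -
  have "bracket x y \<in> lower_central (Suc q)" if "y \<in> lower_central q" for x y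
    using that by (auto intro: span_base)
  then show ?thesis using assms by (auto simp: center_def)
qed

lemma center_nontrivial:
  assumes "step_nilpotent p"
  shows "center \<noteq> {0}"
proof -
  obtain q where q: "p = Suc q" using assms by (cases p) (auto simp: step_nilpotent_def)
  then have "lower_central q \<noteq> {0}" "lower_central q \<subseteq> center"
    using assms by (auto simp: step_nilpotent_def intro!: lower_central_subset_center
        simp del: lower_central.simps)
  moreover have "0 \<in> lower_central q" by (cases q) (auto intro: span_zero)
  ultimately show ?thesis by blast
qed

end

text \<open>A square matrix of size \<open>m\<close> is a function on pairs of indices, of which only those below \<open>m\<close> count.\<close>

primrec mat_pow :: "nat \<Rightarrow> (nat \<Rightarrow> nat \<Rightarrow> 'k::field) \<Rightarrow> nat \<Rightarrow> nat \<Rightarrow> nat \<Rightarrow> 'k" where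
  "mat_pow m A 0 i j = (if i = j then 1 else 0)"
| "mat_pow m A (Suc N) i j = (\<Sum>l<m. A i l * mat_pow m A N l j)"

lemma mat_pow_upper_triangular:
  assumes tri: "\<And>i j. i < m \<Longrightarrow> j < m \<Longrightarrow> j < i \<Longrightarrow> A i j = 0" and "j < m"
  shows "(\<forall>i<m. j < i \<longrightarrow> mat_pow m A N i j = 0) \<and> mat_pow m A N j j = A j j ^ N"
proof (induction N)
  case (Suc N)
  have off: "A i l * mat_pow m A N l j = 0" if "i < m" "j \<le> i" "l < m" "l \<noteq> j" for i l
    using that Suc tri[of i l] by (cases "l < i") auto
  have "mat_pow m A (Suc N) i j = A i j * mat_pow m A N j j" if "i < m" "j \<le> i" for i
  proof -
    have "(\<Sum>l<m. A i l * mat_pow m A N l j) = (\<Sum>l\<in>{j}. A i l * mat_pow m A N l j)"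
      using off[OF that] \<open>j < m\<close> by (intro sum.mono_neutral_right) auto
    then show ?thesis by simp
  qed
  then show ?case using Suc tri \<open>j < m\<close> by auto
qed simp

text \<open>A faithful nilrepresentation written in coordinates.\<close>
locale matrix_nilrep = lie_algebra scale bracket
  for scale :: "'k::field_char_0 \<Rightarrow> 'a::ab_group_add \<Rightarrow> 'a"
    and bracket :: "'a \<Rightarrow> 'a \<Rightarrow> 'a" +
  fixes m :: nat and A :: "'a \<Rightarrow> nat \<Rightarrow> nat \<Rightarrow> 'k"
  assumes A_add: "A (x + y) i j = A x i j + A y i j"
    and A_scale: "A (scale a x) i j = a * A x i j"
    and A_bracket: "i < m \<Longrightarrow> j < m \<Longrightarrow>
      A (bracket x y) i j = (\<Sum>l<m. A x i l * A y l j) - (\<Sum>l<m. A y i l * A x l j)"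
    and A_faithful: "(\<And>i j. i < m \<Longrightarrow> j < m \<Longrightarrow> A x i j = 0) \<Longrightarrow> x = 0"
    and A_nilpotent: "\<exists>N. \<forall>i<m. \<forall>j<m. mat_pow m (A x) N i j = 0"
begin

text \<open>The weight \<open>2 ^ j - 2 ^ i\<close> makes the matrix unit at \<open>(i, j)\<close> a weight vector for conjugation by the
  torus of matrices \<open>diag (t ^ (2 ^ i))\<close>; taking leading positions is the combinatorial shadow of the
  limit of the algebra under this torus.\<close>
definition lead :: "'a \<Rightarrow> nat \<Rightarrow> nat \<Rightarrow> bool" where
  "lead x i j \<longleftrightarrow> i < m \<and> j < m \<and> A x i j \<noteq> 0 \<and>
     (\<forall>k<m. \<forall>l<m. (2::int) ^ l - 2 ^ k < 2 ^ j - 2 ^ i \<longrightarrow> A x k l = 0)"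

definition lead_positions :: "'a set \<Rightarrow> (nat \<times> nat) set" where
  "lead_positions S = {(i, j). \<exists>x\<in>S. lead x i j}"

lemma A_zero: "A 0 i j = 0"
  using A_scale[of 0 0 i j] by simp

lemma lead_nonzero: "lead x i j \<Longrightarrow> x \<noteq> 0"
  using A_zero by (auto simp: lead_def)

text \<open>An entry of negative weight is one below the diagonal, so the hypothesis says that \<open>A x\<close> is
  upper triangular; the diagonal of its powers then consists of the powers of its diagonal.\<close>
lemma upper_triangular_diagonal:
  assumes "\<And>k l. k < m \<Longrightarrow> l < m \<Longrightarrow> (2::int) ^ l - 2 ^ k < 0 \<Longrightarrow> A x k l = 0" "i < m"
  shows "A x i i = 0"
proof -
  obtain N where N: "\<forall>i<m. \<forall>j<m. mat_pow m (A x) N i j = 0" using A_nilpotent by blast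
  have "A x i i ^ N = 0"
    using mat_pow_upper_triangular[of m "A x" i N] assms N by auto
  then show ?thesis by simp
qed

lemma lead_neq: "lead x i j \<Longrightarrow> i \<noteq> j"
  using upper_triangular_diagonal[of x i] by (auto simp: lead_def)

lemma dim_eq_card_lead_positions:
  assumes "finite_dimensional_vector_space scale Basis" "subspace S"
  shows "dim S = card (lead_positions S)"
proof -
  interpret F: finite_dimensional_vector_space scale Basis by fact
  define Q where "Q = {..<m} \<times> {..<m}"
  \<comment> \<open>All diagonal positions have weight 0, so ties are broken by the row to get a linear order.\<close>
  define key :: "nat \<times> nat \<Rightarrow> int" where
    "key = (\<lambda>(i, j). (2 ^ j - 2 ^ i) * int m + int i)"
  define c where "c = (\<lambda>(i, j) x. A x i j)"
  have key_less: "key (i, j) < key (k, l)"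
    if "(2::int) ^ j - 2 ^ i < 2 ^ l - 2 ^ k" "i < m" for i j k l
  proof -
    have "((2::int) ^ j - 2 ^ i + 1) * int m \<le> (2 ^ l - 2 ^ k) * int m"
      using that by (intro mult_right_mono) auto
    then show ?thesis using that by (simp add: key_def algebra_simps)
  qed
  have key_le: "(2::int) ^ j - 2 ^ i \<le> 2 ^ l - 2 ^ k" if "key (i, j) \<le> key (k, l)" "k < m" for i j k l
    using key_less[of l k j i] that by linarith
  have inj: "inj_on key Q"
  proof (rule inj_onI, clarsimp simp: Q_def)
    fix i j k l assume *: "key (i, j) = key (k, l)" "i < m" "j < m" "k < m" "l < m"
    have w: "(2::int) ^ j - 2 ^ i = 2 ^ l - 2 ^ k"
      using key_le[of i j k l] key_le[of k l i j] * by linarith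
    then have "i = k" using *(1) by (simp add: key_def)
    then show "i = k \<and> j = l" using w by simp
  qed
  have lead_iff: "leading Q key c x (i, j) \<longleftrightarrow> lead x i j" for x i j
  proof
    assume "leading Q key c x (i, j)"
    then show "lead x i j" using key_less by (auto simp: leading_def lead_def Q_def c_def)
  next
    assume L: "lead x i j"
    have "A x k l = 0" if "k < m" "l < m" "key (k, l) < key (i, j)" for k l
    proof (cases "(2::int) ^ l - 2 ^ k = 2 ^ j - 2 ^ i")
      case True
      then have "i = k \<and> j = l" using lead_neq[OF L] by (intro pow2_diff_inj) auto
      then show ?thesis using that by simp
    next
      case False
      then show ?thesis using key_le[of k l i j] that L by (auto simp: lead_def)
    qed
    then show "leading Q key c x (i, j)" using L by (auto simp: leading_def lead_def Q_def c_def)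
  qed
  have "dim S = card {q. \<exists>x\<in>S. leading Q key c x q}"
  proof (rule F.dim_eq_card_leading[OF _ inj _ _ assms(2)])
    show "finite Q" by (simp add: Q_def)
    show "x = 0" if "\<forall>q\<in>Q. c q x = 0" for x
      using that by (intro A_faithful) (auto simp: Q_def c_def)
  qed (auto simp: c_def A_add A_scale)
  also have "{q. \<exists>x\<in>S. leading Q key c x q} = lead_positions S"
    using lead_iff by (auto simp: lead_positions_def)
  finally show ?thesis .
qed

text \<open>A product of an entry of \<open>x\<close> and an entry of \<open>y\<close> contributing to the position \<open>(a, b)\<close> of either
\<open>x y\<close> or \<open>y x\<close> has total weight that of \<open>(a, b)\<close>, and it vanishes unless both factors have at least
the weight of the leading positions. At \<open>(i, k)\<close> both must therefore have the leading weight. In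
\<open>x y\<close> this leaves one term; in \<open>y x\<close> it leaves none, as the entry of \<open>y\<close> would be at \<open>(i, l)\<close> and at
\<open>(j, k)\<close> simultaneously. The case \<open>i = k\<close> is not excluded here.\<close>
lemma
  assumes X: "lead x i j" and Y: "lead y j k"
  shows bracket_lead_entry: "A (bracket x y) i k = A x i j * A y j k"
    and bracket_lead_below: "a < m \<Longrightarrow> b < m \<Longrightarrow> (2::int) ^ b - 2 ^ a < 2 ^ k - 2 ^ i \<Longrightarrow>
      A (bracket x y) a b = 0"
proof -
  have ij: "i < m" "j < m" "k < m" "i \<noteq> j" "j \<noteq> k"
    using X Y lead_neq[OF X] lead_neq[OF Y] by (auto simp: lead_def)
  have x0: "A x a b = 0" if "a < m" "b < m" "(2::int) ^ b - 2 ^ a < 2 ^ j - 2 ^ i" for a b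
    using X that by (auto simp: lead_def)
  have y0: "A y a b = 0" if "a < m" "b < m" "(2::int) ^ b - 2 ^ a < 2 ^ k - 2 ^ j" for a b
    using Y that by (auto simp: lead_def)
  have "A x i l * A y l k = 0" if "l < m" "l \<noteq> j" for l
  proof -
    have "(2::int) ^ l \<noteq> 2 ^ j" using that by simp
    then show ?thesis using x0[of i l] y0[of l k] ij that by (cases "(2::int) ^ l < 2 ^ j") auto
  qed
  then have s1: "(\<Sum>l<m. A x i l * A y l k) = (\<Sum>l\<in>{j}. A x i l * A y l k)"
    using ij by (intro sum.mono_neutral_right) auto
  have "A y i l * A x l k = 0" if "l < m" for l
  proof -
    have "\<not> (2::int) ^ k - 2 ^ j = 2 ^ l - 2 ^ i"
      using pow2_diff_inj[of k j l i] ij by auto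
    then consider "(2::int) ^ l - 2 ^ i < 2 ^ k - 2 ^ j" | "(2::int) ^ k - 2 ^ l < 2 ^ j - 2 ^ i"
      by linarith
    then show ?thesis using x0[of l k] y0[of i l] ij that by cases auto
  qed
  then have s2: "(\<Sum>l<m. A y i l * A x l k) = 0" by (intro sum.neutral) auto
  show "A (bracket x y) i k = A x i j * A y j k"
    using A_bracket[OF ij(1,3)] s1 s2 by simp
  show "A (bracket x y) a b = 0"
    if ab: "a < m" "b < m" "(2::int) ^ b - 2 ^ a < 2 ^ k - 2 ^ i"
  proof -
    have "A x a l * A y l b = 0" if "l < m" for l
    proof (cases "(2::int) ^ l - 2 ^ a < 2 ^ j - 2 ^ i")
      case False
      then have "(2::int) ^ b - 2 ^ l < 2 ^ k - 2 ^ j" using ab by linarith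
      then show ?thesis using y0 ab that by simp
    qed (use x0 ab that in simp)
    moreover have "A y a l * A x l b = 0" if "l < m" for l
    proof (cases "(2::int) ^ l - 2 ^ a < 2 ^ k - 2 ^ j")
      case False
      then have "(2::int) ^ b - 2 ^ l < 2 ^ j - 2 ^ i" using ab by linarith
      then show ?thesis using x0 ab that by simp
    qed (use y0 ab that in simp)
    ultimately show ?thesis by (simp add: A_bracket[OF ab(1,2)] sum.neutral)
  qed
qed

text \<open>In particular \<open>i \<noteq> k\<close>, by nilpotency: so the relation of leading positions has no cycles.\<close>
lemma bracket_lead:
  assumes X: "lead x i j" and Y: "lead y j k"
  shows "lead (bracket x y) i k"
proof -
  have "A (bracket x y) i k \<noteq> 0"
    using bracket_lead_entry[OF assms] X Y by (simp add: lead_def)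
  then show ?thesis using bracket_lead_below[OF assms] X Y by (simp add: lead_def)
qed

abbreviation "lead_order \<equiv> lead_positions UNIV"

lemma lead_order_trans: "trans lead_order"
  unfolding lead_positions_def by (rule transI) (auto intro: bracket_lead)

lemma lead_order_irrefl: "(i, i) \<notin> lead_order"
  using lead_neq by (auto simp: lead_positions_def)

lemma lead_center_minimal:
  assumes "(i, j) \<in> lead_positions center"
  shows "(h, i) \<notin> lead_order"
proof
  assume "(h, i) \<in> lead_order"
  then obtain x where x: "lead x h i" by (auto simp: lead_positions_def)
  obtain z where z: "z \<in> center" "lead z i j" using assms by (auto simp: lead_positions_def)
  show False using lead_nonzero[OF bracket_lead[OF x z(2)]] z(1) by (auto simp: center_def)
qed

lemma lead_center_maximal:
  assumes "(i, j) \<in> lead_positions center"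
  shows "(j, k) \<notin> lead_order"
proof
  assume "(j, k) \<in> lead_order"
  then obtain x where x: "lead x j k" by (auto simp: lead_positions_def)
  obtain z where z: "z \<in> center" "lead z i j" using assms by (auto simp: lead_positions_def)
  show False using lead_nonzero[OF bracket_lead[OF z(2) x]] z(1) bracket_commute[of z x]
    by (auto simp: center_def)
qed

text \<open>A strict order on a finite set is well-founded, so a nonempty finite chain has a least element.\<close>
lemma lead_chain_least:
  assumes "finite D" "D \<noteq> {}" "total_on D lead_order"
  obtains i where "i \<in> D" "\<And>d. d \<in> D \<Longrightarrow> d \<noteq> i \<Longrightarrow> (i, d) \<in> lead_order"
proof -
  have tr: "trans (Restr lead_order D)" using lead_order_trans by (auto simp: trans_def)
  have "wf (Restr lead_order D)"
  proof (rule finite_acyclic_wf)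
    show "finite (Restr lead_order D)" using assms(1) by (meson finite_Int finite_SigmaI)
    show "acyclic (Restr lead_order D)"
      using lead_order_irrefl trancl_id[OF tr] by (auto simp: acyclic_def)
  qed
  then obtain i where "i \<in> D" "\<And>d. (d, i) \<in> Restr lead_order D \<Longrightarrow> d \<notin> D"
    using assms(2) unfolding wf_eq_minimal by (metis ex_in_conv)
  then show ?thesis using that[of i] assms(3) unfolding total_on_def by blast
qed

text \<open>Bracketing, from the top of the chain \<open>D\<close> downwards, elements that lead at its consecutive pairs
  reaches one term further down the lower central series with each step.\<close>
lemma lead_chain:
  assumes "card D = Suc (Suc q)" "total_on D lead_order"
    "i \<in> D" "\<And>d. d \<in> D \<Longrightarrow> d \<noteq> i \<Longrightarrow> (i, d) \<in> lead_order"
  shows "\<exists>k\<in>D. \<exists>x\<in>lower_central q. lead x i k"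
  using assms
proof (induction q arbitrary: D i)
  case 0
  then obtain k where "k \<in> D" "k \<noteq> i"
    by (metis card_2_iff' numeral_2_eq_2)
  then show ?case using 0(4) by (fastforce simp: lead_positions_def)
next
  case (Suc q)
  define D' where "D' = D - {i}"
  have fin: "finite D" using Suc.prems(1) by (metis card.infinite nat.distinct(1))
  have cD': "card D' = Suc (Suc q)" using Suc.prems by (simp add: D'_def)
  then have D': "finite D'" "D' \<noteq> {}" using card_ge_0_finite[of D'] by auto
  have tot: "total_on D' lead_order" using Suc.prems(2) by (auto simp: total_on_def D'_def)
  obtain j where j: "j \<in> D'" "\<And>d. d \<in> D' \<Longrightarrow> d \<noteq> j \<Longrightarrow> (j, d) \<in> lead_order"
    using lead_chain_least[OF D' tot] by blast
  obtain k y where ky: "k \<in> D'" "y \<in> lower_central q" "lead y j k"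
    using Suc.IH[OF cD' tot j] by blast
  have "(i, j) \<in> lead_order" using Suc.prems(4) j(1) by (auto simp: D'_def)
  then obtain x where "lead x i j" by (auto simp: lead_positions_def)
  then have "lead (bracket x y) i k" using ky by (intro bracket_lead)
  moreover have "bracket x y \<in> lower_central (Suc q)" using ky by (auto intro: span_base)
  ultimately show ?case using ky(1) by (auto simp: D'_def)
qed

text \<open>A chain of exactly \<open>p + 1\<close> elements yields an iterated bracket in the last nonzero term of the lower
  central series, which is central.\<close>
lemma lead_chain_center:
  assumes nil: "step_nilpotent p" "p > 1" and D: "finite D" "p + 1 \<le> card D" "total_on D lead_order"
  shows "\<exists>i\<in>D. \<exists>k\<in>D. (i, k) \<in> lead_positions center"
proof -
  obtain E where E: "E \<subseteq> D" "card E = p + 1" using D by (meson obtain_subset_with_card_n)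
  have finE: "finite E" "E \<noteq> {}" using E D finite_subset by auto
  have tot: "total_on E lead_order" using D E by (auto simp: total_on_def)
  obtain i where i: "i \<in> E" "\<And>d. d \<in> E \<Longrightarrow> d \<noteq> i \<Longrightarrow> (i, d) \<in> lead_order"
    using lead_chain_least[OF finE tot] by blast
  have "card E = Suc (Suc (p - 1))" using E nil by simp
  then obtain k x where "k \<in> E" "x \<in> lower_central (p - 1)" "lead x i k"
    using lead_chain[OF _ tot i] by blast
  moreover have "lower_central (p - 1) \<subseteq> center"
    using lower_central_subset_center[of "p - 1"] nil
    by (simp add: step_nilpotent_def del: lower_central.simps)
  ultimately show ?thesis using i(1) E(1) by (auto simp: lead_positions_def)
qed

end

section \<open>A weighted Turan inequality\<close>

lemma sum_squared_le_card_sum_squares: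
  fixes y :: "'v \<Rightarrow> real"
  shows "(sum y D)\<^sup>2 \<le> real (card D) * (\<Sum>i\<in>D. (y i)\<^sup>2)"
proof -
  have "2 * (sum y D)\<^sup>2 = (\<Sum>i\<in>D. \<Sum>j\<in>D. 2 * y i * y j)"
    unfolding power2_eq_square sum_product by (simp add: sum_distrib_left mult.assoc)
  also have "\<dots> \<le> (\<Sum>i\<in>D. \<Sum>j\<in>D. (y i)\<^sup>2 + (y j)\<^sup>2)"
    by (intro sum_mono sum_squares_bound)
  also have "\<dots> = 2 * (real (card D) * (\<Sum>i\<in>D. (y i)\<^sup>2))"
    by (simp add: sum.distrib sum_distrib_left)
  finally show ?thesis by simp
qed

lemma sum_remove_two:
  fixes f :: "'v \<Rightarrow> 'r::comm_monoid_add"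
  assumes "finite S" "a \<in> S" "b \<in> S" "a \<noteq> b"
  shows "sum f S = f a + f b + sum f (S - {a, b})"
proof -
  have "sum f S = sum f {a, b} + sum f (S - {a, b})"
    using sum.subset_diff[of "{a, b}" S f] assms by (simp add: add.commute)
  then show ?thesis using assms(4) by simp
qed

text \<open>\<open>P\<close> is a finite strict order and \<open>Z\<close> a set of marked pairs. By \<open>Z_minimal\<close> and \<open>Z_maximal\<close> a
marked pair consists of the ends of any chain that contains it, so that a chain has at most one.\<close>
locale marked_order =
  fixes W :: "'v set" and P Z :: "('v \<times> 'v) set" and p :: nat
  assumes finite_W: "finite W" and P_sub: "P \<subseteq> W \<times> W"
    and irrefl: "(i, i) \<notin> P" and trans: "trans P"
    and Z_sub: "Z \<subseteq> P"
    and Z_minimal: "(b, t) \<in> Z \<Longrightarrow> (a, b) \<notin> P"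
    and Z_maximal: "(b, t) \<in> Z \<Longrightarrow> (t, a) \<notin> P"
    and long_chain: "finite D \<Longrightarrow> p + 1 \<le> card D \<Longrightarrow> total_on D P \<Longrightarrow>
      \<exists>b\<in>D. \<exists>t\<in>D. (b, t) \<in> Z"
    and p_ge_2: "2 \<le> p"
begin

lemma finite_P: "finite P"
  using finite_W P_sub finite_subset by blast

definition mark :: "real \<Rightarrow> 'v \<times> 'v \<Rightarrow> real" where
  "mark \<kappa> e = (if e \<in> Z then \<kappa> else 1)"

definition form :: "real \<Rightarrow> ('v \<Rightarrow> real) \<Rightarrow> real" where
  "form \<kappa> y = (\<Sum>(i, j)\<in>P. mark \<kappa> (i, j) * (y i * y j))"

definition supp :: "('v \<Rightarrow> real) \<Rightarrow> 'v set" where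
  "supp y = {i\<in>W. y i \<noteq> 0}"

lemma form_const_one: "form \<kappa> (\<lambda>_. 1) = real (card (P - Z)) + \<kappa> * real (card Z)"
proof -
  have "form \<kappa> (\<lambda>_. 1) = (\<Sum>e\<in>P - Z. mark \<kappa> e) + (\<Sum>e\<in>Z. mark \<kappa> e)"
    using sum.subset_diff[OF Z_sub finite_P] by (simp add: form_def case_prod_unfold)
  also have "(\<Sum>e\<in>P - Z. mark \<kappa> e) = (\<Sum>e\<in>P - Z. 1)"
    by (intro sum.cong) (auto simp: mark_def)
  also have "(\<Sum>e\<in>Z. mark \<kappa> e) = (\<Sum>e\<in>Z. \<kappa>)"
    by (intro sum.cong) (auto simp: mark_def)
  finally show ?thesis by simp
qed

text \<open>Moving mass between incomparable elements changes the form linearly: its quadratic part only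
involves the pairs inside \<open>{i, j}\<close>, none of which belongs to \<open>P\<close>.\<close>
lemma form_line:
  assumes ij: "i \<noteq> j" "(i, j) \<notin> P" "(j, i) \<notin> P"
  shows "\<exists>L. \<forall>t. form \<kappa> (y(i := y i + t, j := y j - t)) = form \<kappa> y + t * L"
proof (intro exI allI)
  fix t :: real
  define d :: "'v \<Rightarrow> real" where "d v = (if v = i then 1 else if v = j then -1 else 0)" for v
  have y': "y(i := y i + t, j := y j - t) = (\<lambda>v. y v + t * d v)"
    using ij by (auto simp: d_def fun_eq_iff)
  have dd: "d u * d v = 0" if "(u, v) \<in> P" for u v
    using that ij irrefl by (auto simp: d_def)
  have "form \<kappa> (\<lambda>v. y v + t * d v)
      = (\<Sum>(u, v)\<in>P. mark \<kappa> (u, v) * (y u * y v) + t * (mark \<kappa> (u, v) * (y u * d v + d u * y v)))"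
    unfolding form_def
  proof (intro sum.cong refl, clarify)
    fix u v assume "(u, v) \<in> P"
    have "(y u + t * d u) * (y v + t * d v) = y u * y v + t * (y u * d v + d u * y v) + t * t * (d u * d v)"
      by (simp add: algebra_simps)
    then show "mark \<kappa> (u, v) * ((y u + t * d u) * (y v + t * d v))
        = mark \<kappa> (u, v) * (y u * y v) + t * (mark \<kappa> (u, v) * (y u * d v + d u * y v))"
      using dd[OF \<open>(u, v) \<in> P\<close>] by (simp only: mult_zero_right) (simp add: algebra_simps)
  qed
  then show "form \<kappa> (y(i := y i + t, j := y j - t))
      = form \<kappa> y + t * (\<Sum>(u, v)\<in>P. mark \<kappa> (u, v) * (y u * d v + d u * y v))"
    unfolding y' by (simp add: form_def case_prod_unfold sum.distrib sum_distrib_left)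
qed

text \<open>Since the form is linear along such a move, it does not decrease in one of the two directions.
Going that way until one of the two entries vanishes makes the support smaller.\<close>
lemma concentrate_on_chain:
  assumes "\<And>i. y i \<ge> 0"
  shows "\<exists>y'. (\<forall>i. y' i \<ge> 0) \<and> sum y' W = sum y W \<and> total_on (supp y') P \<and> form \<kappa> y \<le> form \<kappa> y'"
  using assms
proof (induction "card (supp y)" arbitrary: y rule: less_induct)
  case less
  show ?case
  proof (cases "total_on (supp y) P")
    case True
    then show ?thesis using less.prems by (intro exI[of _ y]) auto
  next
    case False
    then obtain i j where ij: "i \<in> supp y" "j \<in> supp y" "i \<noteq> j" "(i, j) \<notin> P" "(j, i) \<notin> P"
      by (auto simp: total_on_def)
    obtain L where L: "\<And>t. form \<kappa> (y(i := y i + t, j := y j - t)) = form \<kappa> y + t * L"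
      using form_line[OF ij(3-5)] by blast
    \<comment> \<open>The largest move that keeps both entries nonnegative, in the direction where the form grows.\<close>
    define t where "t = (if L \<ge> 0 then y j else - y i)"
    define y1 where "y1 = y(i := y i + t, j := y j - t)"
    have W: "i \<in> W" "j \<in> W" and pos: "y i > 0" "y j > 0"
      using ij(1,2) less.prems[of i] less.prems[of j] by (auto simp: supp_def)
    have tL: "t * L \<ge> 0" using pos by (simp add: t_def mult_le_0_iff)
    have fin: "finite (supp y)" using finite_W by (simp add: supp_def)
    have nonneg: "y1 v \<ge> 0" for v using less.prems pos by (auto simp: y1_def t_def)
    have "supp y1 \<subseteq> supp y" using ij(1,2) by (auto simp: y1_def supp_def)
    moreover have "supp y1 \<noteq> supp y"
      using ij(1-3) by (auto simp: y1_def supp_def t_def split: if_splits)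
    ultimately have "card (supp y1) < card (supp y)" using fin by (simp add: psubset_card_mono psubset_eq)
    then obtain y' where y': "\<forall>i. y' i \<ge> 0" "sum y' W = sum y1 W" "total_on (supp y') P"
      "form \<kappa> y1 \<le> form \<kappa> y'"
      using less.hyps[of y1] nonneg by blast
    have "sum y1 W = sum y W"
    proof -
      have "sum f W = f i + f j + sum f (W - {i, j})" for f :: "'v \<Rightarrow> real"
        using sum_remove_two[OF finite_W W ij(3)] .
      note this[of y] this[of y1]
      moreover have "sum y1 (W - {i, j}) = sum y (W - {i, j})"
        by (intro sum.cong) (auto simp: y1_def)
      ultimately show ?thesis using ij(3) by (simp add: y1_def)
    qed
    moreover have "form \<kappa> y \<le> form \<kappa> y1" using L[of t] tL by (simp add: y1_def)
    ultimately show ?thesis using y' by (intro exI[of _ y']) auto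
  qed
qed

text \<open>Here every pair of distinct elements of \<open>C\<close> occurs in \<open>P\<close> in exactly one order.\<close>
lemma chain_form:
  fixes y :: "'v \<Rightarrow> real"
  assumes "finite C" "total_on C P"
  shows "2 * (\<Sum>(i, j)\<in>P \<inter> C \<times> C. y i * y j) = (sum y C)\<^sup>2 - (\<Sum>i\<in>C. (y i)\<^sup>2)"
proof -
  define U where "U = P \<inter> C \<times> C"
  let ?f = "\<lambda>(i, j). y i * y j"
  have fin: "finite U" "finite (U\<inverse>)" "finite (Id_on C)"
    using assms(1) finite_P by (auto simp: U_def Id_on_def)
  have anti: "(j, i) \<notin> P" if "(i, j) \<in> P" for i j
    using that trans irrefl by (meson transD)
  have CC: "C \<times> C = U \<union> U\<inverse> \<union> Id_on C"
    using assms(2) by (auto simp: U_def total_on_def)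
  have disj: "U \<inter> U\<inverse> = {}" "(U \<union> U\<inverse>) \<inter> Id_on C = {}"
    using anti irrefl by (auto simp: U_def)
  have "(sum y C)\<^sup>2 = sum ?f (C \<times> C)"
    by (simp add: power2_eq_square sum_product sum.cartesian_product)
  also have "\<dots> = sum ?f U + sum ?f (U\<inverse>) + sum ?f (Id_on C)"
    unfolding CC using fin disj by (simp add: sum.union_disjoint)
  also have "sum ?f (U\<inverse>) = sum ?f U"
    by (rule sum.reindex_bij_witness[of _ prod.swap prod.swap]) (auto simp: mult.commute)
  also have "sum ?f (Id_on C) = (\<Sum>i\<in>C. (y i)\<^sup>2)"
    by (rule sum.reindex_bij_witness[of _ "\<lambda>i. (i, i)" fst]) (auto simp: power2_eq_square)
  finally show ?thesis by (simp add: U_def)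
qed

text \<open>Let \<open>s\<close> be the mass on the marked pair of the chain, or on an arbitrary element if there is no marked
pair. At most \<open>p - 1\<close> elements remain: otherwise \<open>long_chain\<close> yields a marked pair where none can be.
The pairs inside the remaining part contribute at most \<open>c\<close> times the square of its mass (Cauchy and
Schwarz), the pairs between the two parts the product of the masses, and the marked pair at most
\<open>\<kappa> s\<^sup>2 / 4\<close>.\<close>
lemma form_chain_bound:
  assumes y: "\<And>i. y i \<ge> 0" and chain: "total_on (supp y) P" and \<kappa>: "\<kappa> \<ge> 0"
  shows "\<exists>s. 0 \<le> s \<and> s \<le> sum y W \<and> form \<kappa> y \<le>
    s * (sum y W - s) + (real p - 2) / (2 * (real p - 1)) * (sum y W - s)\<^sup>2 + \<kappa> * s\<^sup>2 / 4"
proof -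
  define C where "C = supp y"
  define c where "c = (real p - 2) / (2 * (real p - 1))"
  have fin: "finite C" using finite_W by (auto simp: C_def supp_def)
  have tot: "total_on C P" using chain by (simp add: C_def)
  have sumC: "sum y W = sum y C"
    using finite_W by (intro sum.mono_neutral_right) (auto simp: C_def supp_def)
  have formC: "form \<kappa> y = (\<Sum>(i, j)\<in>P \<inter> C \<times> C. mark \<kappa> (i, j) * (y i * y j))"
    unfolding form_def using finite_P P_sub
    by (intro sum.mono_neutral_right) (auto simp: C_def supp_def)
  have turan: "(sum y D)\<^sup>2 - (\<Sum>i\<in>D. (y i)\<^sup>2) \<le> 2 * (c * (sum y D)\<^sup>2)"
    if "card D \<le> p - 1" for D
  proof -
    have S: "(\<Sum>i\<in>D. (y i)\<^sup>2) \<ge> 0" by (intro sum_nonneg) auto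
    have "(sum y D)\<^sup>2 \<le> real (card D) * (\<Sum>i\<in>D. (y i)\<^sup>2)"
      by (rule sum_squared_le_card_sum_squares)
    also have "\<dots> \<le> (real p - 1) * (\<Sum>i\<in>D. (y i)\<^sup>2)"
      using that p_ge_2 S by (intro mult_right_mono) auto
    finally have "(sum y D)\<^sup>2 / (real p - 1) \<le> (\<Sum>i\<in>D. (y i)\<^sup>2)"
      using p_ge_2 by (simp add: divide_simps mult.commute)
    moreover have "2 * (c * (sum y D)\<^sup>2) = (sum y D)\<^sup>2 - (sum y D)\<^sup>2 / (real p - 1)"
      using p_ge_2 by (simp add: c_def divide_simps) (simp add: algebra_simps)
    ultimately show ?thesis by linarith
  qed
  show ?thesis
  proof (cases "\<exists>b\<in>C. \<exists>t\<in>C. (b, t) \<in> Z")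
    case True
    then obtain b t where bt: "b \<in> C" "t \<in> C" "(b, t) \<in> Z" by blast
    have "b \<noteq> t" using bt(3) Z_sub irrefl by auto
    define D where "D = C - {b, t}"
    have least: "(b, x) \<in> P" if "x \<in> C" "x \<noteq> b" for x
      using tot that bt Z_minimal[OF bt(3)] by (auto simp: total_on_def)
    have greatest: "(x, t) \<in> P" if "x \<in> C" "x \<noteq> t" for x
      using tot that bt Z_maximal[OF bt(3)] by (auto simp: total_on_def)
    have cardD: "card D \<le> p - 1"
    proof (rule ccontr)
      assume "\<not> card D \<le> p - 1"
      \<comment> \<open>The chain without \<open>b\<close> would have a marked pair, whose lower end is not minimal, being above \<open>b\<close>.\<close>
      moreover have "card (insert t D) = Suc (card D)" using fin by (simp add: D_def)
      ultimately have "p + 1 \<le> card (insert t D)" by simp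
      moreover have "total_on (insert t D) P" using tot bt by (auto simp: total_on_def D_def)
      moreover have "finite (insert t D)" using fin by (simp add: D_def)
      ultimately obtain b' t' where "b' \<in> insert t D" "(b', t') \<in> Z" using long_chain by blast
      moreover from this(1) have "(b, b') \<in> P" using bt least \<open>b \<noteq> t\<close> by (auto simp: D_def)
      ultimately show False using Z_minimal by blast
    qed
    have only: "Z \<inter> C \<times> C = {(b, t)}"
    proof (intro equalityI subsetI; clarsimp simp: bt)
      fix b' t' assume *: "(b', t') \<in> Z" "b' \<in> C" "t' \<in> C"
      show "b' = b \<and> t' = t"
        using least[OF *(2)] greatest[OF *(3)] Z_minimal[OF *(1)] Z_maximal[OF *(1)] by blast
    qed
    have sumsplit: "sum f C = f b + f t + sum f D" for f :: "'v \<Rightarrow> real"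
      unfolding D_def using sum_remove_two[OF fin bt(1,2) \<open>b \<noteq> t\<close>] .
    define U where "U = P \<inter> C \<times> C - {(b, t)}"
    have U: "P \<inter> C \<times> C = insert (b, t) U" "(b, t) \<notin> U" "finite U"
      using bt Z_sub finite_P by (auto simp: U_def)
    have "(i, j) \<notin> Z" if "(i, j) \<in> U" for i j using that only unfolding U_def by blast
    then have "(\<Sum>(i, j)\<in>U. mark \<kappa> (i, j) * (y i * y j)) = (\<Sum>(i, j)\<in>U. y i * y j)"
      by (intro sum.cong refl) (auto simp: mark_def)
    then have f1: "form \<kappa> y = \<kappa> * (y b * y t) + (\<Sum>(i, j)\<in>U. y i * y j)"
      unfolding formC U(1) by (simp add: U(2,3) mark_def bt(3))
    have "2 * (y b * y t + (\<Sum>(i, j)\<in>U. y i * y j)) = (sum y C)\<^sup>2 - (\<Sum>i\<in>C. (y i)\<^sup>2)"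
      using chain_form[OF fin tot, of y] unfolding U(1) by (simp add: U(2,3))
    then have F: "2 * form \<kappa> y = 2 * (\<kappa> * (y b * y t))
        + ((sum y C)\<^sup>2 - (\<Sum>i\<in>C. (y i)\<^sup>2) - 2 * (y b * y t))"
      using f1 by (simp only: distrib_left)
    define s where "s = y b + y t"
    have "(sum y C)\<^sup>2 - (\<Sum>i\<in>C. (y i)\<^sup>2) - 2 * (y b * y t)
        = 2 * (s * sum y D) + ((sum y D)\<^sup>2 - (\<Sum>i\<in>D. (y i)\<^sup>2))"
      unfolding sumsplit[of y] sumsplit[of "\<lambda>i. (y i)\<^sup>2"] s_def
      by (simp add: algebra_simps power2_eq_square)
    moreover have "\<kappa> * (y b * y t) \<le> \<kappa> * (s\<^sup>2 / 4)"
      using sum_squares_bound[of "y b" "y t"] \<kappa>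
      by (intro mult_left_mono) (auto simp: s_def power2_sum)
    ultimately have "form \<kappa> y \<le> s * sum y D + c * (sum y D)\<^sup>2 + \<kappa> * s\<^sup>2 / 4"
      using F turan[OF cardD] by linarith
    moreover have "sum y D = sum y W - s" using sumC sumsplit[of y] by (simp add: s_def)
    moreover have "s \<ge> 0" "sum y D \<ge> 0" using y by (auto simp: s_def intro: sum_nonneg)
    ultimately show ?thesis by (intro exI[of _ s]) (auto simp: c_def)
  next
    case noZ: False
    have cardC: "card C \<le> p" using long_chain[OF fin _ tot] noZ by force
    have "form \<kappa> y = (\<Sum>(i, j)\<in>P \<inter> C \<times> C. y i * y j)"
      unfolding formC using noZ by (intro sum.cong refl) (auto simp: mark_def)
    then have F: "2 * form \<kappa> y = (sum y C)\<^sup>2 - (\<Sum>i\<in>C. (y i)\<^sup>2)"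
      using chain_form[OF fin tot, of y] by simp
    show ?thesis
    proof (cases "C = {}")
      case True
      then show ?thesis using F sumC by (intro exI[of _ 0]) auto
    next
      case False
      then obtain x where x: "x \<in> C" by blast
      define D where "D = C - {x}"
      have "card D \<le> p - 1" using cardC x fin by (simp add: D_def)
      note T = turan[OF this]
      have sumsplit: "sum f C = f x + sum f D" for f :: "'v \<Rightarrow> real"
        using x fin by (simp add: D_def sum.remove)
      have "2 * form \<kappa> y = 2 * (y x * sum y D) + ((sum y D)\<^sup>2 - (\<Sum>i\<in>D. (y i)\<^sup>2))"
        unfolding F sumsplit[of y] sumsplit[of "\<lambda>i. (y i)\<^sup>2"]
        by (simp add: algebra_simps power2_eq_square)
      moreover have "\<kappa> * (y x)\<^sup>2 / 4 \<ge> 0" using \<kappa> by simp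
      ultimately have "form \<kappa> y \<le> y x * sum y D + c * (sum y D)\<^sup>2 + \<kappa> * (y x)\<^sup>2 / 4"
        using T by linarith
      moreover have "sum y D = sum y W - y x" using sumC sumsplit[of y] by simp
      moreover have "sum y D \<ge> 0" using y by (auto intro: sum_nonneg)
      ultimately show ?thesis using y by (intro exI[of _ "y x"]) (auto simp: c_def)
    qed
  qed
qed

text \<open>Turan's theorem in the form of Motzkin and Straus: the left hand side is the value of the form at
the all-ones vector. Keeping \<open>\<kappa>\<close> free is what retains the information about the number of marked
pairs, by duality.\<close>
theorem weighted_turan:
  assumes "\<kappa> \<ge> 0"
  shows "\<exists>s. 0 \<le> s \<and> s \<le> real (card W) \<and> real (card (P - Z)) + \<kappa> * real (card Z) \<le>
    s * (real (card W) - s) + (real p - 2) / (2 * (real p - 1)) * (real (card W) - s)\<^sup>2 + \<kappa> * s\<^sup>2 / 4"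
proof -
  obtain y where y: "\<And>i. y i \<ge> 0" "sum y W = sum (\<lambda>_. 1) W" "total_on (supp y) P"
    "form \<kappa> (\<lambda>_. 1) \<le> form \<kappa> y"
    using concentrate_on_chain[of "\<lambda>_. 1" \<kappa>] by auto
  have "sum y W = real (card W)" using y(2) by simp
  then show ?thesis
    using form_chain_bound[OF y(1,3) assms] y(4) form_const_one[of \<kappa>] by force
qed

end

section \<open>The dimension inequality for a faithful nilrepresentation\<close>

context matrix_nilrep
begin

lemma lead_positions_mono: "S \<subseteq> T \<Longrightarrow> lead_positions S \<subseteq> lead_positions T"
  by (auto simp: lead_positions_def)

text \<open>The bound of \<open>weighted_turan\<close> for the order of leading positions, marked by those of the centre.\<close>
lemma dim_inequality:
  assumes fd: "finite_dimensional_vector_space scale Basis"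
    and nil: "step_nilpotent p" "p > 1" and \<kappa>: "\<kappa> \<ge> 0"
  shows "\<exists>s. 0 \<le> s \<and> s \<le> real m \<and>
    real (dim UNIV) - real (dim center) + \<kappa> * real (dim center) \<le>
    s * (real m - s) + (real p - 2) / (2 * (real p - 1)) * (real m - s)\<^sup>2 + \<kappa> * s\<^sup>2 / 4"
proof -
  interpret M: marked_order "{..<m}" lead_order "lead_positions center" p
  proof
    show "lead_order \<subseteq> {..<m} \<times> {..<m}" by (auto simp: lead_positions_def lead_def)
    show "(b, t) \<in> lead_positions center \<Longrightarrow> (a, b) \<notin> lead_order" for a b t
      by (rule lead_center_minimal)
    show "(b, t) \<in> lead_positions center \<Longrightarrow> (t, a) \<notin> lead_order" for a b t
      by (rule lead_center_maximal)
    show "\<exists>b\<in>D. \<exists>t\<in>D. (b, t) \<in> lead_positions center"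
      if "finite D" "p + 1 \<le> card D" "total_on D lead_order" for D
      using lead_chain_center[OF nil that] .
  qed (use nil in \<open>auto simp: lead_order_irrefl lead_order_trans lead_positions_mono\<close>)
  have n: "dim UNIV = card lead_order"
    using dim_eq_card_lead_positions[OF fd subspace_UNIV] .
  have z: "dim center = card (lead_positions center)"
    using dim_eq_card_lead_positions[OF fd subspace_center] .
  have "finite (lead_positions center)" using M.Z_sub M.finite_P finite_subset by blast
  then have "card (lead_order - lead_positions center) = dim UNIV - dim center"
    and "dim center \<le> dim UNIV"
    unfolding n z using M.Z_sub M.finite_P by (auto simp: card_Diff_subset card_mono)
  then have "real (card (lead_order - lead_positions center)) = real (dim UNIV) - real (dim center)"
    by simp
  then show ?thesis using M.weighted_turan[OF \<kappa>] by (simp add: z)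
qed

end

lemma (in faithful_nilrepresentation) ex_matrix_nilrep:
  "\<exists>A. matrix_nilrep scale bracket (V.dim V) A"
proof -
  obtain B0 where B0: "finite B0" "V.span B0 = V" using finite_dim by blast
  have sV: "V.subspace V" using B0 V.subspace_span by blast
  obtain B where B: "B \<subseteq> V" "V.independent B" "V \<subseteq> V.span B" "card B = V.dim V"
    using V.basis_exists by blast
  have finB: "finite B" using V.independent_span_bound[OF B0(1) B(2)] B(1) B0(2) by blast
  have spB: "V.span B = V" using B sV V.span_minimal by blast
  define m where "m = V.dim V"
  obtain e where e: "bij_betw e {..<m} B"
    using ex_bij_betw_nat_finite[OF finB] B(4) by (auto simp: m_def lessThan_atLeast0)
  have eV: "e i \<in> V" if "i < m" for i using e that B(1) by (auto simp: bij_betw_def)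
  define R where "R = V.representation B"
  have R_add: "R (v + w) b = R v b + R w b" if "v \<in> V" "w \<in> V" for v w b
    using that spB by (simp add: R_def V.representation_add[OF B(2)])
  have R_diff: "R (v - w) b = R v b - R w b" if "v \<in> V" "w \<in> V" for v w b
    using that spB by (simp add: R_def V.representation_diff[OF B(2)])
  have R_scale: "R (scaleV a v) b = a * R v b" if "v \<in> V" for a v b
    using that spB by (simp add: R_def V.representation_scale[OF B(2)])
  have R_e: "R (e j) (e i) = (if i = j then 1 else 0)" if "i < m" "j < m" for i j
  proof -
    have "e j \<in> B" and "e i = e j \<longleftrightarrow> i = j" using e that by (auto simp: bij_betw_def inj_on_def)
    then show ?thesis using V.representation_basis[OF B(2)] by (simp add: R_def)
  qed
  have expand: "v = (\<Sum>l<m. scaleV (R v (e l)) (e l))" if "v \<in> V" for v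
  proof -
    have "(\<Sum>l<m. scaleV (R v (e l)) (e l)) = (\<Sum>b\<in>B. scaleV (R v b) b)"
      by (rule sum.reindex_bij_betw[OF e])
    also have "\<dots> = v" unfolding R_def
      using V.sum_representation_eq[OF B(2) _ finB order_refl] spB that by simp
    finally show ?thesis ..
  qed
  have pi0: "\<pi> x 0 = 0" for x
    using rep_scale[of 0 x 0] V.subspace_0[OF sV] by simp
  have coord: "R (\<pi> x (\<Sum>l\<in>L. scaleV (f l) (e l))) b = (\<Sum>l\<in>L. f l * R (\<pi> x (e l)) b)
      \<and> (\<Sum>l\<in>L. scaleV (f l) (e l)) \<in> V" if "finite L" "L \<subseteq> {..<m}" for L x f b
    using that
  proof (induction L rule: finite_induct)
    case empty
    then show ?case using pi0 V.subspace_0[OF sV] by (simp add: R_def V.representation_zero)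
  next
    case (insert l L)
    have l: "e l \<in> V" using insert eV by simp
    have in_V: "scaleV (f l) (e l) \<in> V" "(\<Sum>l\<in>L. scaleV (f l) (e l)) \<in> V"
      using insert V.subspace_scale[OF sV l] by auto
    have "\<pi> x (scaleV (f l) (e l) + (\<Sum>l\<in>L. scaleV (f l) (e l)))
        = scaleV (f l) (\<pi> x (e l)) + \<pi> x (\<Sum>l\<in>L. scaleV (f l) (e l))"
      using in_V l by (simp add: rep_add rep_scale)
    moreover have "scaleV (f l) (\<pi> x (e l)) \<in> V" "\<pi> x (\<Sum>l\<in>L. scaleV (f l) (e l)) \<in> V"
      using l in_V rep_closed V.subspace_scale[OF sV] by auto
    ultimately show ?case using insert in_V l
      by (simp add: R_add R_scale rep_closed V.subspace_add[OF sV])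
  qed
  \<comment> \<open>Outside the index range the values of \<open>e\<close> are arbitrary, hence the default 0.\<close>
  define A where "A x i j = (if i < m \<and> j < m then R (\<pi> x (e j)) (e i) else 0)" for x i j
  have A_apply: "R (\<pi> x v) (e i) = (\<Sum>l<m. A x i l * R v (e l))"
    if "v \<in> V" and i: "i < m" for x v i
  proof -
    have "R (\<pi> x v) (e i) = R (\<pi> x (\<Sum>l<m. scaleV (R v (e l)) (e l))) (e i)"
      using expand[OF that(1)] by simp
    also have "\<dots> = (\<Sum>l<m. R v (e l) * R (\<pi> x (e l)) (e i))"
      using conjunct1[OF coord[OF finite_lessThan order_refl]] .
    finally show ?thesis using i by (simp add: A_def mult.commute)
  qed
  have zero: "v = 0" if "v \<in> V" "\<And>i. i < m \<Longrightarrow> R v (e i) = 0" for v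
    using expand[OF that(1)] that(2) by simp
  have pow_V: "(\<pi> x ^^ N) v \<in> V" if "v \<in> V" for x N v
    using that by (induction N) (auto simp: rep_closed)
  have pow: "R ((\<pi> x ^^ N) (e j)) (e i) = mat_pow m (A x) N i j" if "i < m" "j < m" for x N i j
    using that
  proof (induction N arbitrary: i)
    case (Suc N)
    have "R ((\<pi> x ^^ Suc N) (e j)) (e i) = (\<Sum>l<m. A x i l * R ((\<pi> x ^^ N) (e j)) (e l))"
      using A_apply[OF pow_V[OF eV[OF Suc.prems(2)]] Suc.prems(1)] by simp
    then show ?case using Suc by simp
  qed (simp add: R_e)
  have "matrix_nilrep scale bracket m A"
  proof
    fix x y a
    show "A (x + y) i j = A x i j + A y i j" for i j
      using eV by (simp add: A_def rep_add_left R_add rep_closed)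
    show "A (scale a x) i j = a * A x i j" for i j
      using eV by (simp add: A_def rep_scale_left R_scale rep_closed)
    show "x = 0" if A0: "\<And>i j. i < m \<Longrightarrow> j < m \<Longrightarrow> A x i j = 0"
    proof -
      have "\<pi> x v = \<pi> 0 v" if v: "v \<in> V" for v
      proof -
        have "\<pi> x v = 0"
          using v A0 by (intro zero) (simp_all add: rep_closed A_apply)
        moreover have "\<pi> 0 v = 0" using rep_scale_left[OF v, of 0 0] by simp
        ultimately show ?thesis by simp
      qed
      then have "restrict (\<pi> x) V = restrict (\<pi> 0) V" by (auto simp: restrict_def)
      then show ?thesis using rep_faithful by (auto dest: injD)
    qed
    show "A (bracket x y) i j = (\<Sum>l<m. A x i l * A y l j) - (\<Sum>l<m. A y i l * A x l j)"
      if "i < m" "j < m" for i j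
    proof -
      have "A (bracket x y) i j = R (\<pi> x (\<pi> y (e j))) (e i) - R (\<pi> y (\<pi> x (e j))) (e i)"
        using eV[OF that(2)] that by (simp add: A_def rep_bracket R_diff rep_closed)
      also have "\<dots> = (\<Sum>l<m. A x i l * A y l j) - (\<Sum>l<m. A y i l * A x l j)"
        using that by (simp add: A_apply[OF rep_closed[OF eV[OF that(2)]] that(1)] A_def)
      finally show ?thesis .
    qed
    show "\<exists>N. \<forall>i<m. \<forall>j<m. mat_pow m (A x) N i j = 0"
    proof -
      obtain N where "\<forall>v\<in>V. (\<pi> x ^^ N) v = 0" using rep_nilpotent by blast
      then show ?thesis using pow[symmetric] eV
        by (intro exI[of _ N]) (simp add: R_def V.representation_zero)
    qed
  qed
  then show ?thesis by (auto simp: m_def)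
qed

section \<open>The two bounds as consequences of the dimension inequality\<close>

text \<open>The maximum is at \<open>s = m / P\<close>; its value is the number of edges of the
  complete multipartite graph on \<open>m\<close> vertices with \<open>P\<close> equal parts.\<close>
lemma max_two_part_form:
  fixes P m s :: real
  assumes "P > 1"
  shows "s * (m - s) + (P - 2) / (2 * (P - 1)) * (m - s)\<^sup>2 \<le> (P - 1) / (2 * P) * m\<^sup>2"
proof -
  have "(P - 1) / (2 * P) * m\<^sup>2 - (s * (m - s) + (P - 2) / (2 * (P - 1)) * (m - s)\<^sup>2)
      = (P * s - m)\<^sup>2 / (2 * P * (P - 1))"
    using assms by (simp add: divide_simps) (simp add: algebra_simps power2_eq_square)
  moreover have "(P * s - m)\<^sup>2 / (2 * P * (P - 1)) \<ge> 0" using assms by simp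
  ultimately show ?thesis by linarith
qed

lemma small_center_bound:
  fixes P m g :: real
  assumes "P > 1" "m \<ge> 0" "g \<le> s * (m - s) + (P - 2) / (2 * (P - 1)) * (m - s)\<^sup>2"
  shows "sqrt (2 * P / (P - 1) * g) \<le> m"
proof -
  have "g \<le> (P - 1) / (2 * P) * m\<^sup>2" using assms max_two_part_form[of P s m] by linarith
  then have "2 * P / (P - 1) * g \<le> 2 * P / (P - 1) * ((P - 1) / (2 * P) * m\<^sup>2)"
    using assms by (intro mult_left_mono) auto
  also have "\<dots> = m\<^sup>2" using assms by simp
  finally show ?thesis using assms by (simp add: real_le_lsqrt)
qed

text \<open>The pairs \<open>(z, g)\<close> allowed by \<open>dual\<close> form a convex region, whose boundary is parametrised by
\<open>s = 2 sqrt z\<close> for \<open>m \<le> P s\<close>. Each point of that boundary is reached by a supporting line, of slope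
\<open>- \<kappa>\<close>.\<close>
lemma tangent_bound:
  fixes P m g z :: real
  defines "c \<equiv> (P - 2) / (2 * (P - 1))"
  assumes P: "P \<ge> 2" and pos: "m \<ge> 0" "z > 0" "g \<ge> 0"
    and dual: "\<And>\<kappa>. \<kappa> \<ge> 0 \<Longrightarrow> \<exists>s. 0 \<le> s \<and> s \<le> m \<and>
      g + \<kappa> * z \<le> s * (m - s) + c * (m - s)\<^sup>2 + \<kappa> * s\<^sup>2 / 4"
    and large: "m \<le> P * (2 * sqrt z)"
  shows "2 * sqrt z \<le> m \<and> g \<le> 2 * sqrt z * (m - 2 * sqrt z) + c * (m - 2 * sqrt z)\<^sup>2"
proof
  define t where "t = 2 * sqrt z"
  have t: "t > 0" "t\<^sup>2 = 4 * z" using pos by (auto simp: t_def power_mult_distrib)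
  have c: "0 \<le> c" "c \<le> 1" using P by (auto simp: c_def divide_simps)
  show "2 * sqrt z \<le> m"
  proof (rule ccontr)
    assume "\<not> 2 * sqrt z \<le> m"
    then have "m\<^sup>2 < t\<^sup>2" using pos by (intro power_strict_mono) (auto simp: t_def)
    then have gap: "4 * z - m\<^sup>2 > 0" using t by simp
    \<comment> \<open>If \<open>z\<close> exceeded \<open>m\<^sup>2 / 4\<close>, the terms with \<open>\<kappa>\<close> would win for large \<open>\<kappa>\<close>.\<close>
    define \<kappa> where "\<kappa> = 4 * (2 * m\<^sup>2 + 1) / (4 * z - m\<^sup>2)"
    have \<kappa>: "\<kappa> \<ge> 0" using gap by (simp add: \<kappa>_def)
    obtain s where s: "0 \<le> s" "s \<le> m"
      "g + \<kappa> * z \<le> s * (m - s) + c * (m - s)\<^sup>2 + \<kappa> * s\<^sup>2 / 4"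
      using dual[OF \<kappa>] by blast
    have "s * (m - s) \<le> m * m" using s by (intro mult_mono) auto
    moreover have "c * (m - s)\<^sup>2 \<le> 1 * m\<^sup>2" using s c by (intro mult_mono power_mono) auto
    moreover have "\<kappa> * s\<^sup>2 / 4 \<le> \<kappa> * m\<^sup>2 / 4"
      using s \<kappa> by (intro divide_right_mono mult_left_mono power_mono) auto
    ultimately have "\<kappa> * (4 * z - m\<^sup>2) / 4 \<le> 2 * m\<^sup>2"
      using s pos by (simp add: algebra_simps power2_eq_square)
    then show False using gap by (simp add: \<kappa>_def)
  qed
  \<comment> \<open>The value for which the derivative in \<open>s\<close> of the right hand side of \<open>dual\<close> vanishes at \<open>t\<close>.\<close>
  define \<kappa> where "\<kappa> = 2 / (P - 1) * (P - m / t)"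
  have "m \<le> P * t" using large by (simp only: t_def)
  then have "m / t \<le> P" using t by (simp add: divide_simps mult.commute)
  then have \<kappa>: "\<kappa> \<ge> 0" using P by (simp add: \<kappa>_def)
  obtain s where s: "0 \<le> s" "s \<le> m"
    "g + \<kappa> * z \<le> s * (m - s) + c * (m - s)\<^sup>2 + \<kappa> * s\<^sup>2 / 4"
    using dual[OF \<kappa>] by blast
  have "(t * (m - t) + c * (m - t)\<^sup>2 + \<kappa> * t\<^sup>2 / 4) - (s * (m - s) + c * (m - s)\<^sup>2 + \<kappa> * s\<^sup>2 / 4)
      = m * (s - t)\<^sup>2 / (2 * (P - 1) * t)"
    using P t(1) unfolding c_def \<kappa>_def
    by (simp add: divide_simps) (simp add: algebra_simps power2_eq_square)
  moreover have "m * (s - t)\<^sup>2 / (2 * (P - 1) * t) \<ge> 0" using P t pos by simp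
  ultimately have "g + \<kappa> * z \<le> t * (m - t) + c * (m - t)\<^sup>2 + \<kappa> * t\<^sup>2 / 4" using s by linarith
  then show "g \<le> 2 * sqrt z * (m - 2 * sqrt z) + c * (m - 2 * sqrt z)\<^sup>2"
    using t by (simp add: t_def)
qed

text \<open>For \<open>m \<le> 2 P sqrt z\<close> this solves for \<open>m\<close> the quadratic inequality of \<open>tangent_bound\<close>; for larger \<open>m\<close>,
the hypothesis \<open>le\<close> keeps the bound below \<open>2 P sqrt z\<close>, the value that it takes in the case of
equality.\<close>
lemma large_center_bound:
  fixes P m n z :: real
  defines "c \<equiv> (P - 2) / (2 * (P - 1))"
  assumes P: "P \<ge> 2" and pos: "m \<ge> 0" "z > 0" "z \<le> n"
    and dual: "\<And>\<kappa>. \<kappa> \<ge> 0 \<Longrightarrow> \<exists>s. 0 \<le> s \<and> s \<le> m \<and>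
      n - z + \<kappa> * z \<le> s * (m - s) + c * (m - s)\<^sup>2 + \<kappa> * s\<^sup>2 / 4"
    and le: "n \<le> ((P - 1)\<^sup>2 + P\<^sup>2) * z"
  shows "(if P = 2 then (n + 3 * z) / (2 * sqrt z)
          else sqrt (2 * (P - 1) / (P - 2) * n + 2 * P * (P - 1) / (P - 2)\<^sup>2 * z)
               - 2 / (P - 2) * sqrt z) \<le> m" (is "?b \<le> m")
proof (cases "m \<le> P * (2 * sqrt z)")
  case True
  define t where "t = sqrt z"
  have t: "t > 0" "z = t\<^sup>2" using pos by (auto simp: t_def)
  have u: "2 * t \<le> m" "n - z \<le> 2 * t * (m - 2 * t) + c * (m - 2 * t)\<^sup>2"
    using tangent_bound[of P m z "n - z"] assms True by (auto simp: t_def)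
  show ?thesis
  proof (cases "P = 2")
    case 2: True
    then have "n + 3 * z \<le> m * (2 * t)"
      using u unfolding t(2) by (simp add: c_def algebra_simps power2_eq_square)
    then show ?thesis using 2 t(1) by (simp add: pos_divide_le_eq flip: t_def)
  next
    case False
    then have P2: "P > 2" using P by simp
    define d where "d = 2 * (P - 1) / (P - 2)"
    have d: "d > 0" "d * c = 1" using P2 by (auto simp: d_def c_def divide_simps)
    \<comment> \<open>The number whose square has to be compared with the radicand.\<close>
    define w where "w = m + 2 / (P - 2) * t"
    have w0: "w \<ge> 0" using P2 t pos by (simp add: w_def)
    have "d * (n - z) \<le> d * (2 * t * (m - 2 * t) + c * (m - 2 * t)\<^sup>2)"
      using d u by (intro mult_left_mono) auto
    also have "\<dots> = 2 * d * t * (m - 2 * t) + (m - 2 * t)\<^sup>2"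
      by (simp only: distrib_left mult.assoc[symmetric] d(2))
    finally have *: "d * n \<le> d * t\<^sup>2 + 2 * d * t * (m - 2 * t) + (m - 2 * t)\<^sup>2"
      using t by (simp add: algebra_simps)
    have "w\<^sup>2 = d * t\<^sup>2 + 2 * d * t * (m - 2 * t) + (m - 2 * t)\<^sup>2 + 2 * P * (P - 1) / (P - 2)\<^sup>2 * t\<^sup>2"
      using P2 unfolding w_def d_def
      by (simp add: divide_simps) (simp add: algebra_simps power2_eq_square)
    then have "d * n + 2 * P * (P - 1) / (P - 2)\<^sup>2 * z \<le> w\<^sup>2" using * t by simp
    then have "sqrt (d * n + 2 * P * (P - 1) / (P - 2)\<^sup>2 * z) \<le> w" using w0 by (simp add: real_le_lsqrt)
    then show ?thesis using False by (simp add: d_def w_def t_def)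
  qed
next
  case False
  define t where "t = sqrt z"
  have t: "t > 0" "z = t\<^sup>2" using pos by (auto simp: t_def)
  have "?b \<le> 2 * P * t"
  proof (cases "P = 2")
    case 2: True
    then have "n + 3 * z \<le> 2 * P * t * (2 * t)"
      using le unfolding t(2) by (simp add: algebra_simps power2_eq_square)
    then show ?thesis using 2 t(1) by (simp add: pos_divide_le_eq flip: t_def)
  next
    case False
    then have P2: "P > 2" using P by simp
    have "2 * (P - 1) / (P - 2) * n \<le> 2 * (P - 1) / (P - 2) * (((P - 1)\<^sup>2 + P\<^sup>2) * t\<^sup>2)"
      using P2 le t by (intro mult_left_mono) auto
    moreover have "2 * (P - 1) / (P - 2) * (((P - 1)\<^sup>2 + P\<^sup>2) * t\<^sup>2) + 2 * P * (P - 1) / (P - 2)\<^sup>2 * t\<^sup>2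
      = (2 * (P - 1)\<^sup>2 / (P - 2) * t)\<^sup>2"
      using P2 by (simp add: divide_simps) (simp add: algebra_simps power2_eq_square power4_eq_xxxx)
    ultimately have "2 * (P - 1) / (P - 2) * n + 2 * P * (P - 1) / (P - 2)\<^sup>2 * z
        \<le> (2 * (P - 1)\<^sup>2 / (P - 2) * t)\<^sup>2"
      using t by simp
    then have "sqrt (2 * (P - 1) / (P - 2) * n + 2 * P * (P - 1) / (P - 2)\<^sup>2 * z)
        \<le> 2 * (P - 1)\<^sup>2 / (P - 2) * t"
      using P2 t by (intro real_le_lsqrt) auto
    moreover have "2 * (P - 1)\<^sup>2 / (P - 2) * t - 2 / (P - 2) * t = 2 * P * t"
      using P2 by (simp add: divide_simps) (simp add: algebra_simps power2_eq_square)
    ultimately show ?thesis using False by (simp add: t_def)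
  qed
  then show ?thesis using False by (simp add: t_def)
qed

text \<open>After clearing denominators the claim is \<open>n > P\<^sup>2 z\<close>.\<close>
lemma small_center_bound_improves:
  fixes P n z :: real
  assumes "P \<ge> 2" "z > 0" "n \<ge> ((P - 1)\<^sup>2 + P\<^sup>2) * z"
  shows "sqrt (2 * P / (P - 1) * (n - z)) > sqrt (2 * (P + 1) / P * n)"
proof -
  have "n > P\<^sup>2 * z"
  proof -
    have "(P - 1)\<^sup>2 * z > 0" using assms by simp
    then show ?thesis using assms(3) by (simp add: algebra_simps)
  qed
  moreover have "2 * P / (P - 1) * (n - z) - 2 * (P + 1) / P * n = 2 * (n - P\<^sup>2 * z) / (P * (P - 1))"
    using assms by (simp add: divide_simps) (simp add: algebra_simps power2_eq_square)
  moreover have "2 * (n - P\<^sup>2 * z) / (P * (P - 1)) > 0" using assms calculation(1) by simp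
  ultimately have "2 * (P + 1) / P * n < 2 * P / (P - 1) * (n - z)" by linarith
  then show ?thesis by simp
qed

text \<open>Moving the subtracted root to the other side and squaring leaves the inequality between the
arithmetic and the geometric mean: of \<open>n\<close> and \<open>3 z\<close> if \<open>P = 2\<close>, and of \<open>2 n / P\<close> and \<open>(P + 1) z\<close>
otherwise.\<close>
lemma large_center_bound_improves:
  fixes P n z :: real
  assumes P: "P \<ge> 2" and pos: "z > 0" "n \<ge> 0"
  shows "(if P = 2 then (n + 3 * z) / (2 * sqrt z)
          else sqrt (2 * (P - 1) / (P - 2) * n + 2 * P * (P - 1) / (P - 2)\<^sup>2 * z)
               - 2 / (P - 2) * sqrt z) \<ge> sqrt (2 * (P + 1) / P * n)" (is "?b \<ge> _")
proof (cases "P = 2")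
  case True
  have "12 * n * z \<le> (n + 3 * z)\<^sup>2"
    using zero_le_power2[of "n - 3 * z"] by (simp add: algebra_simps power2_eq_square)
  then have "3 * n \<le> ((n + 3 * z) / (2 * sqrt z))\<^sup>2"
    using pos by (simp add: power_divide power_mult_distrib divide_simps)
  then have "sqrt (3 * n) \<le> (n + 3 * z) / (2 * sqrt z)" using pos by (intro real_le_lsqrt) auto
  then show ?thesis using True by simp
next
  case False
  then have P2: "P > 2" using P by simp
  define a where "a = sqrt (2 / P * n)"
  define b where "b = sqrt ((P + 1) * z)"
  define t where "t = sqrt z"
  define r where "r = sqrt (2 * (P + 1) / P * n)"
  have sq: "a\<^sup>2 = 2 / P * n" "b\<^sup>2 = (P + 1) * z" "t\<^sup>2 = z" "r\<^sup>2 = 2 * (P + 1) / P * n"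
    using P2 pos by (auto simp: a_def b_def t_def r_def)
  have rt: "r * t = a * b"
    using P2 pos unfolding a_def b_def t_def r_def by (simp flip: real_sqrt_mult add: mult_ac)
  have "(r + 2 / (P - 2) * t)\<^sup>2 = r\<^sup>2 + 4 / (P - 2) * (r * t) + 4 / (P - 2)\<^sup>2 * t\<^sup>2"
    using P2 by (simp add: divide_simps) (simp add: algebra_simps power2_eq_square)
  also have "\<dots> = r\<^sup>2 + 2 / (P - 2) * (2 * (a * b)) + 4 / (P - 2)\<^sup>2 * t\<^sup>2" by (simp add: rt)
  also have "\<dots> \<le> r\<^sup>2 + 2 / (P - 2) * (a\<^sup>2 + b\<^sup>2) + 4 / (P - 2)\<^sup>2 * t\<^sup>2"
    using P2 sum_squares_bound[of a b]
    by (intro add_mono mult_left_mono) (auto simp: mult.assoc)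
  also have "\<dots> = 2 * (P - 1) / (P - 2) * n + 2 * P * (P - 1) / (P - 2)\<^sup>2 * z"
    using P2 unfolding sq by (simp add: divide_simps) (simp add: algebra_simps power2_eq_square)
  finally have "r + 2 / (P - 2) * t \<le> sqrt (2 * (P - 1) / (P - 2) * n + 2 * P * (P - 1) / (P - 2)\<^sup>2 * z)"
    by (rule real_le_rsqrt)
  then show ?thesis using False by (simp add: r_def t_def)
qed

theorem theorem1p2:
  fixes scale :: "'k::field_char_0 \<Rightarrow> 'a::ab_group_add \<Rightarrow> 'a"
    and bracket :: "'a \<Rightarrow> 'a \<Rightarrow> 'a"
    and Basis :: "'a set"
    and p :: nat
  assumes "lie_algebra scale bracket"
    and "finite_dimensional_vector_space scale Basis"
    and "lie_algebra.step_nilpotent scale bracket p"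
    and "p > 1"
  shows "let P = real p;
             n = real (vector_space.dim scale (UNIV :: 'a set));
             z = real (vector_space.dim scale (lie_algebra.center bracket));
             \<mu> = ereal_of_enat (lie_algebra.mu_nil scale bracket);
             bound1 = sqrt (2 * P / (P - 1) * (n - z));
             bound2 = (if p = 2 then (n + 3 * z) / (2 * sqrt z)
                       else sqrt (2 * (P - 1) / (P - 2) * n + 2 * P * (P - 1) / (P - 2)\<^sup>2 * z)
                            - 2 / (P - 2) * sqrt z)
         in (n \<ge> ((P - 1)\<^sup>2 + P\<^sup>2) * z \<longrightarrow>
               \<mu> \<ge> ereal bound1 \<and> bound1 > sqrt (2 * (P + 1) / P * n)) \<and>
            (n \<le> ((P - 1)\<^sup>2 + P\<^sup>2) * z \<longrightarrow>
               \<mu> \<ge> ereal bound2 \<and> bound2 \<ge> sqrt (2 * (P + 1) / P * n))"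
proof -
  interpret lie_algebra scale bracket by fact
  interpret F: finite_dimensional_vector_space scale Basis by fact
  define P n z where "P = real p" and "n = real (dim (UNIV :: 'a set))" and "z = real (dim center)"
  define b1 where "b1 = sqrt (2 * P / (P - 1) * (n - z))"
  define b2 where "b2 = (if P = 2 then (n + 3 * z) / (2 * sqrt z)
    else sqrt (2 * (P - 1) / (P - 2) * n + 2 * P * (P - 1) / (P - 2)\<^sup>2 * z) - 2 / (P - 2) * sqrt z)"
  have P: "P \<ge> 2" using assms(4) by (simp add: P_def)
  have "\<not> center \<subseteq> {0}"
    using center_nontrivial[OF assms(3)] subspace_0[OF subspace_center] by blast
  then have "dim center \<noteq> 0" by simp
  then have z: "z > 0" unfolding z_def by linarith
  have zn: "z \<le> n" unfolding z_def n_def of_nat_le_iff by (rule F.dim_subset[OF subset_UNIV])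
  have rep_bounds: "b1 \<le> real (vector_space.dim fun_scale V)
      \<and> (n \<le> ((P - 1)\<^sup>2 + P\<^sup>2) * z \<longrightarrow> b2 \<le> real (vector_space.dim fun_scale V))"
    if "faithful_nilrepresentation scale bracket fun_scale V \<pi>" for V \<pi>
  proof -
    interpret R: faithful_nilrepresentation scale bracket fun_scale V \<pi> by fact
    obtain A where "matrix_nilrep scale bracket (R.V.dim V) A" using R.ex_matrix_nilrep by blast
    then interpret M: matrix_nilrep scale bracket "R.V.dim V" A .
    define m where "m = real (R.V.dim V)"
    have dual: "\<exists>s. 0 \<le> s \<and> s \<le> m \<and> n - z + \<kappa> * z \<le>
        s * (m - s) + (P - 2) / (2 * (P - 1)) * (m - s)\<^sup>2 + \<kappa> * s\<^sup>2 / 4" if "\<kappa> \<ge> 0" for \<kappa>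
      using M.dim_inequality[OF assms(2-4) that] unfolding m_def n_def z_def P_def .
    obtain s where "n - z \<le> s * (m - s) + (P - 2) / (2 * (P - 1)) * (m - s)\<^sup>2"
      using dual[of 0] by auto
    then have "b1 \<le> m" unfolding b1_def using P by (intro small_center_bound) (auto simp: m_def)
    moreover have "b2 \<le> m" if "n \<le> ((P - 1)\<^sup>2 + P\<^sup>2) * z"
      unfolding b2_def using P z zn dual that by (intro large_center_bound) (auto simp: m_def)
    ultimately show ?thesis by (simp add: m_def)
  qed
  \<comment> \<open>A nonempty set of extended naturals contains its infimum, and the empty one has infimum \<open>\<infinity>\<close>.\<close>
  have mu: "ereal b \<le> ereal_of_enat mu_nil"
    if "\<And>V \<pi>. faithful_nilrepresentation scale bracket fun_scale V \<pi> \<Longrightarrow>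
      b \<le> real (vector_space.dim fun_scale V)" for b
  proof (cases "mu_nil = \<infinity>")
    case False
    define S where "S = {enat (vector_space.dim fun_scale V) |V \<pi>.
      faithful_nilrepresentation scale bracket fun_scale V \<pi>}"
    have mu_S: "mu_nil = Inf S" unfolding mu_nil_def S_def ..
    then have "S \<noteq> {}" using False by (metis Inf_empty top_enat_def)
    then have "mu_nil \<in> S" unfolding mu_S Inf_enat_def by (auto intro: LeastI_ex)
    then show ?thesis using that by (auto simp: S_def)
  qed simp
  have "P = 2 \<longleftrightarrow> p = 2" by (auto simp: P_def)
  moreover have "ereal b1 \<le> ereal_of_enat mu_nil" using rep_bounds by (intro mu) blast
  moreover have "ereal b2 \<le> ereal_of_enat mu_nil" if "n \<le> ((P - 1)\<^sup>2 + P\<^sup>2) * z"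
    using rep_bounds that by (intro mu) blast
  moreover have "b1 > sqrt (2 * (P + 1) / P * n)" if "n \<ge> ((P - 1)\<^sup>2 + P\<^sup>2) * z"
    unfolding b1_def using P z that by (rule small_center_bound_improves)
  moreover have "b2 \<ge> sqrt (2 * (P + 1) / P * n)"
    unfolding b2_def using P z zn by (intro large_center_bound_improves) auto
  ultimately show ?thesis
    unfolding Let_def P_def[symmetric] n_def[symmetric] z_def[symmetric] b1_def b2_def by simp
qed

end
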